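(* Let $X$ be a non-compact proper metric space. Then $X$ is coarsely equivalent to $\mathbb{N}$ if and only if the following two conditions are satisfied: (i) $X$ is coarsely geodesic and has coarse bounded geometry, and (ii) the Higson corona $\nu X$ is an indecomposable continuum.
   Context: $\mathbb{R}_+=[0,\infty)$ carries the metric $d(x,y)=|x-y|$, and $\mathbb{N}\subset\mathbb{R}_+$ is the space of natural numbers with the induced metric. A metric space $(X,d_X)$ is proper if every closed ball $B(x,r)=\{y\in X : d_X(x,y)\le r\}$ is compact. Coarse equivalence: A (not necessarily continuous) function $f:X\to Y$ between metric spaces is a coarse map if (a) there is a non-decreasing function $\sigma:\mathbb{R}_+\to\mathbb{R}_+$ with $d_Y(f(x),f(x'))\le\sigma(d_X(x,x'))$ for all $x,x'\in X$, and (b) $f^{-1}(B)$ is bounded for every bounded $B\subset Y$. Two maps $f,g:X\to Y$ are close if there is $r>0$ with $d_Y(f(x),g(x))<r$ for all $x\in X$. A coarse map $f:X\to Y$ is a coarse equivalence if there is a coarse map $g:Y\to X$ such that $g\circ f$ is close to $\mathrm{id}_X$ and $f\circ g$ is close to $\mathrm{id}_Y$; then $X$ and $Y$ are called coarsely equivalent. A metric space is coarsely geodesic if it is coarsely equivalent to a geodesic metric space. A subset $A\subset X$ is a net if there is $r>0$ such that for every $x\in X$ there is $a\in A$ with $d_X(x,a)<r$. A metric space $X$ has coarse bounded geometry if there exist a net $A$ of $X$ and a function $\lambda:\mathbb{R}_+\to\mathbb{R}_+$ such that $\#(A\cap B(x,t))\le\lambda(t)$ for every $x\in X$ and $t>0$.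 Higson corona: for a proper metric space $X$, let $C_H(X)$ be the set of bounded continuous functions $f:X\to\mathbb{R}$ such that for all $r>0$ and $\varepsilon>0$ there is a compact $K\subset X$ with $\operatorname{diam} f(B(x,r))<\varepsilon$ for all $x\in X\setminus K$. The evaluation map $e:X\to\prod_{f\in C_H(X)}[\inf f,\sup f]$, $(e(x))_f=f(x)$, is a topological embedding; the Higson compactification $X^\nu$ is the closure of $e(X)$ (with $X$ identified with $e(X)$), and the Higson corona is $\nu X=X^\nu\setminus X$. A continuum is a non-empty compact connected Hausdorff space; it is decomposable if it is the union of two of its proper subcontinua (subcontinua not equal to the whole space), and indecomposable otherwise. *)

theory Defs
  imports "HOL-Analysis.Analysis"
begin

section \<open>Proper and geodesic metric spaces\<close>

definition proper_metric :: "'a metric \<Rightarrow> bool" where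
  "proper_metric X \<longleftrightarrow>
     (\<forall>x \<in> mspace X. \<forall>r. compactin (mtopology_of X) (mcball_of X x r))"

definition geodesic_metric :: "'a metric \<Rightarrow> bool" where
  "geodesic_metric X \<longleftrightarrow>
     (\<forall>x \<in> mspace X. \<forall>y \<in> mspace X.
        \<exists>\<gamma> \<in> {0..mdist X x y} \<rightarrow> mspace X.
          \<gamma> 0 = x \<and> \<gamma> (mdist X x y) = y \<and>
          (\<forall>s \<in> {0..mdist X x y}. \<forall>t \<in> {0..mdist X x y}. mdist X (\<gamma> s) (\<gamma> t) = \<bar>s - t\<bar>))"

abbreviation mbounded_of :: "'a metric \<Rightarrow> 'a set \<Rightarrow> bool" where
  "mbounded_of X \<equiv> Metric_space.mbounded (mspace X) (mdist X)"


section \<open>Coarse equivalence\<close>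

definition coarse_map :: "'a metric \<Rightarrow> 'b metric \<Rightarrow> ('a \<Rightarrow> 'b) \<Rightarrow> bool" where
  "coarse_map X Y f \<longleftrightarrow>
     f \<in> mspace X \<rightarrow> mspace Y \<and>
     (\<exists>\<sigma>::real \<Rightarrow> real. \<sigma> \<in> {0..} \<rightarrow> {0..} \<and> mono_on {0..} \<sigma> \<and>
        (\<forall>x \<in> mspace X. \<forall>x' \<in> mspace X. mdist Y (f x) (f x') \<le> \<sigma> (mdist X x x'))) \<and>
     (\<forall>B \<subseteq> mspace Y. mbounded_of Y B \<longrightarrow> mbounded_of X {x \<in> mspace X. f x \<in> B})"

definition close_maps :: "'a metric \<Rightarrow> 'b metric \<Rightarrow> ('a \<Rightarrow> 'b) \<Rightarrow> ('a \<Rightarrow> 'b) \<Rightarrow> bool" where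
  "close_maps X Y f g \<longleftrightarrow> (\<exists>r>0. \<forall>x \<in> mspace X. mdist Y (f x) (g x) < r)"

definition coarse_equivalence :: "'a metric \<Rightarrow> 'b metric \<Rightarrow> ('a \<Rightarrow> 'b) \<Rightarrow> bool" where
  "coarse_equivalence X Y f \<longleftrightarrow>
     coarse_map X Y f \<and>
     (\<exists>g. coarse_map Y X g \<and> close_maps X X (g \<circ> f) id \<and> close_maps Y Y (f \<circ> g) id)"

definition coarsely_equivalent :: "'a metric \<Rightarrow> 'b metric \<Rightarrow> bool" where
  "coarsely_equivalent X Y \<longleftrightarrow> (\<exists>f. coarse_equivalence X Y f)"

text \<open>
  HOL cannot quantify existentially over the type that carries the geodesic space. The type
  \<open>'a + real\<close> below is large enough for this to be no restriction: by \<open>coarsely_geodesicI\<close>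
  a geodesic space over any type whatsoever that is coarsely equivalent to \<open>X\<close> makes \<open>X\<close>
  coarsely geodesic.
\<close>

definition coarsely_geodesic :: "'a metric \<Rightarrow> bool" where
  "coarsely_geodesic X \<longleftrightarrow>
     (\<exists>Y :: ('a + real) metric. geodesic_metric Y \<and> coarsely_equivalent X Y)"

lemma coarse_equivalence_isometric_part:
  assumes f: "coarse_equivalence X Y f"
    and k: "k \<in> mspace Z \<rightarrow> mspace Y"
    and iso: "\<And>u v. u \<in> mspace Z \<Longrightarrow> v \<in> mspace Z \<Longrightarrow> mdist Y (k u) (k v) = mdist Z u v"
    and f': "f' \<in> mspace X \<rightarrow> mspace Z"
    and kf': "\<And>x. x \<in> mspace X \<Longrightarrow> k (f' x) = f x"
  shows "coarse_equivalence X Z f'"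
proof -
  from f obtain g where cf: "coarse_map X Y f" and cg: "coarse_map Y X g"
    and gf: "close_maps X X (g \<circ> f) id" and fg: "close_maps Y Y (f \<circ> g) id"
    unfolding coarse_equivalence_def by blast
  have dist_f': "mdist Z (f' x) (f' x') = mdist Y (f x) (f x')"
    if "x \<in> mspace X" "x' \<in> mspace X" for x x'
    using iso[of "f' x" "f' x'"] f' kf' that by (auto simp: Pi_iff)
  have bZ: "mbounded_of Y (k ` B)" if "B \<subseteq> mspace Z" and B: "mbounded_of Z B" for B
  proof -
    obtain c where c: "\<forall>u \<in> B. \<forall>v \<in> B. mdist Z u v \<le> c"
      using B by (auto simp: Metric_space.mbounded_alt)
    have "mdist Y (k u) (k v) \<le> c" if "u \<in> B" "v \<in> B" for u v
      using c iso[OF subsetD[OF \<open>B \<subseteq> mspace Z\<close>] subsetD[OF \<open>B \<subseteq> mspace Z\<close>]] that by simp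
    moreover have "k ` B \<subseteq> mspace Y" using \<open>B \<subseteq> mspace Z\<close> k by auto
    ultimately show ?thesis by (auto simp: Metric_space.mbounded_alt)
  qed
  have cf': "coarse_map X Z f'"
    unfolding coarse_map_def
  proof (intro conjI allI impI)
    show "f' \<in> mspace X \<rightarrow> mspace Z" by (fact f')
    show "\<exists>\<sigma>::real \<Rightarrow> real. \<sigma> \<in> {0..} \<rightarrow> {0..} \<and> mono_on {0..} \<sigma> \<and>
        (\<forall>x \<in> mspace X. \<forall>x' \<in> mspace X. mdist Z (f' x) (f' x') \<le> \<sigma> (mdist X x x'))"
      using cf unfolding coarse_map_def by (simp add: dist_f')
  next
    fix B assume B: "B \<subseteq> mspace Z" "mbounded_of Z B"
    have "k ` B \<subseteq> mspace Y" using B k by auto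
    then have "mbounded_of X {x \<in> mspace X. f x \<in> k ` B}"
      using cf bZ[OF B] unfolding coarse_map_def by blast
    moreover have "{x \<in> mspace X. f' x \<in> B} \<subseteq> {x \<in> mspace X. f x \<in> k ` B}"
      using kf' by force
    ultimately show "mbounded_of X {x \<in> mspace X. f' x \<in> B}"
      using Metric_space.mbounded_subset[OF Metric_space_mspace_mdist] by blast
  qed
  have cg': "coarse_map Z X (g \<circ> k)"
    unfolding coarse_map_def
  proof (intro conjI allI impI)
    show "g \<circ> k \<in> mspace Z \<rightarrow> mspace X" using cg k by (auto simp: coarse_map_def)
    from cg obtain \<sigma> :: "real \<Rightarrow> real" where \<sigma>: "\<sigma> \<in> {0..} \<rightarrow> {0..}" "mono_on {0..} \<sigma>"
      "\<forall>y \<in> mspace Y. \<forall>y' \<in> mspace Y. mdist X (g y) (g y') \<le> \<sigma> (mdist Y y y')"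
      unfolding coarse_map_def by blast
    have "mdist X ((g \<circ> k) u) ((g \<circ> k) v) \<le> \<sigma> (mdist Z u v)"
      if "u \<in> mspace Z" "v \<in> mspace Z" for u v
    proof -
      have "k u \<in> mspace Y" "k v \<in> mspace Y" using k that by auto
      then have "mdist X (g (k u)) (g (k v)) \<le> \<sigma> (mdist Y (k u) (k v))" using \<sigma>(3) by blast
      then show ?thesis using iso[OF that] by simp
    qed
    with \<sigma> show "\<exists>\<sigma>::real \<Rightarrow> real. \<sigma> \<in> {0..} \<rightarrow> {0..} \<and> mono_on {0..} \<sigma> \<and>
        (\<forall>u \<in> mspace Z. \<forall>v \<in> mspace Z. mdist X ((g \<circ> k) u) ((g \<circ> k) v) \<le> \<sigma> (mdist Z u v))"
      by (intro exI[of _ \<sigma>]) simp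
  next
    fix B assume "B \<subseteq> mspace X" "mbounded_of X B"
    then have "mbounded_of Y {y \<in> mspace Y. g y \<in> B}"
      using cg unfolding coarse_map_def by blast
    then obtain c where c: "\<forall>x \<in> {y \<in> mspace Y. g y \<in> B}. \<forall>y \<in> {y \<in> mspace Y. g y \<in> B}. mdist Y x y \<le> c"
      by (auto simp: Metric_space.mbounded_alt)
    have "mdist Z u v \<le> c" if "u \<in> mspace Z" "v \<in> mspace Z" "g (k u) \<in> B" "g (k v) \<in> B" for u v
    proof -
      have "k u \<in> mspace Y" "k v \<in> mspace Y" using k that by auto
      then have "mdist Y (k u) (k v) \<le> c" using c that by blast
      then show ?thesis using iso[OF that(1,2)] by simp
    qed
    then show "mbounded_of Z {u \<in> mspace Z. (g \<circ> k) u \<in> B}"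
      by (auto simp: Metric_space.mbounded_alt)
  qed
  have g'f': "close_maps X X ((g \<circ> k) \<circ> f') id"
    using gf kf' unfolding close_maps_def by simp
  have f'g': "close_maps Z Z (f' \<circ> (g \<circ> k)) id"
  proof -
    obtain r where r: "r > 0" "\<forall>y \<in> mspace Y. mdist Y ((f \<circ> g) y) (id y) < r"
      using fg unfolding close_maps_def by blast
    have "mdist Z (f' (g (k u))) u < r" if u: "u \<in> mspace Z" for u
    proof -
      have ku: "k u \<in> mspace Y" using k u by auto
      then have gku: "g (k u) \<in> mspace X" using cg by (auto simp: coarse_map_def)
      then have "mdist Z (f' (g (k u))) u = mdist Y (f (g (k u))) (k u)"
        using iso[of "f' (g (k u))" u] f' kf' u by (auto simp: Pi_iff)
      then show ?thesis using r(2) ku by simp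
    qed
    with r(1) show ?thesis unfolding close_maps_def by auto
  qed
  show ?thesis
    unfolding coarse_equivalence_def using cf' cg' g'f' f'g' by blast
qed

lemma geodesic_hull_bound:
  includes cardinal_syntax
  fixes Y :: "'b metric" and S :: "'b set"
  assumes Y: "geodesic_metric Y" and S: "S \<subseteq> mspace Y"
    and card: "|S| \<le>o |UNIV :: ('a + real) set|"
  obtains A where "S \<subseteq> A" "A \<subseteq> mspace Y" "geodesic_metric (submetric Y A)"
    "|A| \<le>o |UNIV :: ('a + real) set|"
proof -
  let ?U = "UNIV :: ('a + real) set"
  let ?I = "\<lambda>p. {0..mdist Y (fst p) (snd p)}"
  have inf: "\<not> finite ?U" by (simp add: infinite_UNIV_char_0)
  have ctm: "|N :: nat set| \<le>o |?U|" for N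
    by (rule ordLeq_transitive[OF card_of_mono1[OF subset_UNIV]])
      (rule iffD1[OF infinite_iff_card_of_nat inf])
  have real: "|R :: real set| \<le>o |?U|" for R
    by (rule iffD1[OF card_of_ordLeq], rule exI[of _ Inr]) auto
  define P where "P = (\<lambda>p g. g \<in> ?I p \<rightarrow> mspace Y \<and> g 0 = fst p \<and>
      g (mdist Y (fst p) (snd p)) = snd p \<and>
      (\<forall>s \<in> ?I p. \<forall>t \<in> ?I p. mdist Y (g s) (g t) = \<bar>s - t\<bar>))"
  define \<gamma> where "\<gamma> = (\<lambda>p. SOME g. P p g)"
  have \<gamma>: "P (x, y) (\<gamma> (x, y))" if "x \<in> mspace Y" "y \<in> mspace Y" for x y
  proof -
    have "\<exists>g. P (x, y) g"
      using bspec[OF bspec[OF Y[unfolded geodesic_metric_def] that(1)] that(2)]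
      by (auto simp: P_def)
    then show ?thesis unfolding \<gamma>_def by (rule someI_ex)
  qed
  define H where "H = rec_nat S (\<lambda>_ T. T \<union> (\<Union>p \<in> T \<times> T. \<gamma> p ` ?I p))"
  have H0: "H 0 = S" and HSuc: "H (Suc n) = H n \<union> (\<Union>p \<in> H n \<times> H n. \<gamma> p ` ?I p)" for n
    by (simp_all add: H_def)
  have HY: "H n \<subseteq> mspace Y" for n
  proof (induction n)
    case 0 then show ?case using S H0 by simp
  next
    case (Suc n)
    have "\<gamma> (x, y) s \<in> mspace Y" if "x \<in> H n" "y \<in> H n" "s \<in> ?I (x, y)" for x y s
      using \<gamma>[of x y] Suc that unfolding P_def by blast
    with Suc show ?case unfolding HSuc by fastforce
  qed
  have Hcard: "|H n| \<le>o |?U|" for n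
  proof (induction n)
    case 0 then show ?case using card H0 by simp
  next
    case (Suc n)
    have "|H n \<times> H n| \<le>o |?U|"
      by (rule card_of_Sigma_ordLeq_infinite[OF inf Suc]) (use Suc in simp)
    moreover have "\<forall>p \<in> H n \<times> H n. |\<gamma> p ` ?I p| \<le>o |?U|"
      using ordLeq_transitive[OF card_of_image real] by blast
    ultimately have "|\<Union>p \<in> H n \<times> H n. \<gamma> p ` ?I p| \<le>o |?U|"
      by (rule card_of_UNION_ordLeq_infinite[OF inf])
    then show ?case unfolding HSuc
      by (intro card_of_Un_ordLeq_infinite_Field[where r = "|?U|"] Suc card_of_Card_order)
        (use inf in \<open>simp_all only: Field_card_of not_False_eq_True\<close>)
  qed
  have Hmono: "H m \<subseteq> H n" if "m \<le> n" for m n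
    using that by (rule lift_Suc_mono_le[rotated]) (simp add: HSuc)
  define A where "A = (\<Union>n. H n)"
  have AY: "A \<subseteq> mspace Y" using HY by (auto simp: A_def)
  have "geodesic_metric (submetric Y A)"
    unfolding geodesic_metric_def
  proof (intro ballI)
    fix x y assume "x \<in> mspace (submetric Y A)" "y \<in> mspace (submetric Y A)"
    then have xy: "x \<in> A" "y \<in> A" "x \<in> mspace Y" "y \<in> mspace Y" by auto
    then obtain m n where "x \<in> H m" "y \<in> H n" by (auto simp: A_def)
    then have mn: "x \<in> H (max m n)" "y \<in> H (max m n)"
      using Hmono[of m "max m n"] Hmono[of n "max m n"] by auto
    have "\<gamma> (x, y) s \<in> A" if "s \<in> ?I (x, y)" for s
    proof -
      have "\<gamma> (x, y) s \<in> H (Suc (max m n))" unfolding HSuc using mn that by blast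
      then show ?thesis by (auto simp: A_def)
    qed
    then show "\<exists>\<gamma> \<in> {0..mdist (submetric Y A) x y} \<rightarrow> mspace (submetric Y A).
          \<gamma> 0 = x \<and> \<gamma> (mdist (submetric Y A) x y) = y \<and>
          (\<forall>s \<in> {0..mdist (submetric Y A) x y}. \<forall>t \<in> {0..mdist (submetric Y A) x y}.
             mdist (submetric Y A) (\<gamma> s) (\<gamma> t) = \<bar>s - t\<bar>)"
      using \<gamma>[OF xy(3,4)] xy AY by (intro bexI[of _ "\<gamma> (x, y)"]) (auto simp: P_def)
  qed
  moreover have "|A| \<le>o |?U|"
    unfolding A_def using card_of_UNION_ordLeq_infinite[OF inf ctm] Hcard by blast
  moreover have "S \<subseteq> A" using H0 by (auto simp: A_def)
  ultimately show ?thesis using AY that by blast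
qed

theorem coarsely_geodesicI:
  includes cardinal_syntax
  fixes X :: "'a metric" and Y :: "'b metric"
  assumes Y: "geodesic_metric Y" and XY: "coarsely_equivalent X Y"
  shows "coarsely_geodesic X"
proof -
  let ?U = "UNIV :: ('a + real) set"
  obtain f where f: "coarse_equivalence X Y f"
    using XY unfolding coarsely_equivalent_def by blast
  then have fY: "f \<in> mspace X \<rightarrow> mspace Y"
    unfolding coarse_equivalence_def coarse_map_def by blast
  have "|mspace X| \<le>o |?U|"
    by (rule iffD1[OF card_of_ordLeq], rule exI[of _ Inl]) auto
  then have card: "|f ` mspace X| \<le>o |?U|"
    using card_of_image ordLeq_transitive by blast
  have sub: "f ` mspace X \<subseteq> mspace Y" using fY by auto
  from geodesic_hull_bound[OF Y sub card] obtain A where A: "f ` mspace X \<subseteq> A" "A \<subseteq> mspace Y"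
    "geodesic_metric (submetric Y A)" "|A| \<le>o |?U|" .
  obtain h :: "'b \<Rightarrow> 'a + real" where h: "inj_on h A"
    using iffD2[OF card_of_ordLeq A(4)] by auto
  define k where "k = inv_into A h"
  have kh: "k (h a) = a" if "a \<in> A" for a
    using that h by (simp add: k_def)
  define d where "d = (\<lambda>u v. mdist Y (k u) (k v))"
  have ms: "Metric_space (h ` A) d"
  proof
    show "0 \<le> d u v" "d u v = d v u" for u v
      by (simp_all add: d_def mdist_commute)
    show "d u v = 0 \<longleftrightarrow> u = v" if "u \<in> h ` A" "v \<in> h ` A" for u v
      using that A(2) by (auto simp: d_def kh subset_iff inj_on_eq_iff[OF h])
    show "d u w \<le> d u v + d v w" if "u \<in> h ` A" "v \<in> h ` A" "w \<in> h ` A" for u v w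
      using that A(2) by (auto simp: d_def kh subset_iff intro: mdist_triangle)
  qed
  define Z where "Z = metric (h ` A, d)"
  have Z: "mspace Z = h ` A" "mdist Z = d"
    using Metric_space.mspace_metric[OF ms] Metric_space.mdist_metric[OF ms] by (simp_all add: Z_def)
  have "geodesic_metric Z"
    unfolding geodesic_metric_def
  proof (intro ballI)
    fix u v assume "u \<in> mspace Z" "v \<in> mspace Z"
    then obtain a b where ab: "a \<in> A" "b \<in> A" "u = h a" "v = h b" by (auto simp: Z)
    then have dab: "d u v = mdist Y a b" by (simp add: d_def kh)
    have "a \<in> mspace (submetric Y A)" "b \<in> mspace (submetric Y A)"
      using ab A(2) by auto
    from bspec[OF bspec[OF A(3)[unfolded geodesic_metric_def] this(1)] this(2)]
    obtain \<gamma> where \<gamma>: "\<gamma> \<in> {0..mdist Y a b} \<rightarrow> A" "\<gamma> 0 = a" "\<gamma> (mdist Y a b) = b"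
      "\<forall>s \<in> {0..mdist Y a b}. \<forall>t \<in> {0..mdist Y a b}. mdist Y (\<gamma> s) (\<gamma> t) = \<bar>s - t\<bar>"
      by auto
    show "\<exists>\<gamma> \<in> {0..mdist Z u v} \<rightarrow> mspace Z. \<gamma> 0 = u \<and> \<gamma> (mdist Z u v) = v \<and>
      (\<forall>s \<in> {0..mdist Z u v}. \<forall>t \<in> {0..mdist Z u v}. mdist Z (\<gamma> s) (\<gamma> t) = \<bar>s - t\<bar>)"
    proof (intro bexI[of _ "h \<circ> \<gamma>"] conjI ballI)
      fix s t assume "s \<in> {0..mdist Z u v}" "t \<in> {0..mdist Z u v}"
      then have st: "s \<in> {0..mdist Y a b}" "t \<in> {0..mdist Y a b}" by (simp_all add: Z dab)
      then have "\<gamma> s \<in> A" "\<gamma> t \<in> A" using \<gamma>(1) by blast+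
      then show "mdist Z ((h \<circ> \<gamma>) s) ((h \<circ> \<gamma>) t) = \<bar>s - t\<bar>"
        using \<gamma>(4) st by (simp add: Z d_def kh)
    next
      show "h \<circ> \<gamma> \<in> {0..mdist Z u v} \<rightarrow> mspace Z" using \<gamma>(1) by (auto simp: Z dab)
    next
      show "(h \<circ> \<gamma>) 0 = u" using \<gamma>(2) ab(3) by simp
      show "(h \<circ> \<gamma>) (mdist Z u v) = v" unfolding Z dab using \<gamma>(3) ab(4) by simp
    qed
  qed
  moreover have "coarse_equivalence X Z (h \<circ> f)"
    using f
  proof (rule coarse_equivalence_isometric_part[where k = k])
    show "k \<in> mspace Z \<rightarrow> mspace Y" using A(2) by (auto simp: Z kh)
    show "mdist Y (k u) (k v) = mdist Z u v" for u v by (simp add: Z d_def)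
    show "h \<circ> f \<in> mspace X \<rightarrow> mspace Z" using A(1) by (auto simp: Z)
    show "k ((h \<circ> f) x) = f x" if "x \<in> mspace X" for x
      using kh[of "f x"] that A(1) by auto
  qed
  ultimately show ?thesis
    unfolding coarsely_geodesic_def coarsely_equivalent_def by blast
qed


section \<open>Coarse bounded geometry\<close>

definition is_net :: "'a metric \<Rightarrow> 'a set \<Rightarrow> bool" where
  "is_net X A \<longleftrightarrow> A \<subseteq> mspace X \<and> (\<exists>r>0. \<forall>x \<in> mspace X. \<exists>a \<in> A. mdist X x a < r)"

definition coarse_bounded_geometry :: "'a metric \<Rightarrow> bool" where
  "coarse_bounded_geometry X \<longleftrightarrow>
     (\<exists>A. \<exists>l::real \<Rightarrow> real. is_net X A \<and> l \<in> {0..} \<rightarrow> {0..} \<and>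
        (\<forall>x \<in> mspace X. \<forall>t>0.
           finite (A \<inter> mcball_of X x t) \<and> real (card (A \<inter> mcball_of X x t)) \<le> l t))"


section \<open>The Higson corona\<close>

text \<open>
  Elements of \<open>C\<^sub>H(X)\<close> are functions on \<open>mspace X\<close> only; requiring extensionality makes the HOL
  function representing such a map unique.
\<close>

definition higson_functions :: "'a metric \<Rightarrow> ('a \<Rightarrow> real) set" where
  "higson_functions X =
     {f \<in> extensional (mspace X).
        continuous_map (mtopology_of X) euclideanreal f \<and> bounded (f ` mspace X) \<and>
        (\<forall>r>0. \<forall>\<epsilon>>0. \<exists>K. compactin (mtopology_of X) K \<and>
           (\<forall>x \<in> mspace X - K. diameter (f ` mcball_of X x r) < \<epsilon>))}"

definition higson_cube :: "'a metric \<Rightarrow> (('a \<Rightarrow> real) \<Rightarrow> real) topology" where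
  "higson_cube X =
     product_topology (\<lambda>f. top_of_set {Inf (f ` mspace X)..Sup (f ` mspace X)})
       (higson_functions X)"

definition higson_eval :: "'a metric \<Rightarrow> 'a \<Rightarrow> ('a \<Rightarrow> real) \<Rightarrow> real" where
  "higson_eval X x = (\<lambda>f \<in> higson_functions X. f x)"

definition higson_compactification :: "'a metric \<Rightarrow> (('a \<Rightarrow> real) \<Rightarrow> real) topology" where
  "higson_compactification X =
     subtopology (higson_cube X) (higson_cube X closure_of (higson_eval X ` mspace X))"

definition higson_corona :: "'a metric \<Rightarrow> (('a \<Rightarrow> real) \<Rightarrow> real) topology" where
  "higson_corona X =
     subtopology (higson_compactification X)
       (topspace (higson_compactification X) - higson_eval X ` mspace X)"


section \<open>Continua\<close>

definition continuum :: "'a topology \<Rightarrow> bool" where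
  "continuum T \<longleftrightarrow>
     topspace T \<noteq> {} \<and> compact_space T \<and> connected_space T \<and> Hausdorff_space T"

definition proper_subcontinuum :: "'a topology \<Rightarrow> 'a set \<Rightarrow> bool" where
  "proper_subcontinuum T A \<longleftrightarrow> A \<subset> topspace T \<and> continuum (subtopology T A)"

definition decomposable :: "'a topology \<Rightarrow> bool" where
  "decomposable T \<longleftrightarrow>
     (\<exists>A B. proper_subcontinuum T A \<and> proper_subcontinuum T B \<and> A \<union> B = topspace T)"

definition indecomposable_continuum :: "'a topology \<Rightarrow> bool" where
  "indecomposable_continuum T \<longleftrightarrow> continuum T \<and> \<not> decomposable T"

end

theory Submission
  imports Defs "HOL-Library.Diagonal_Subsequence"
begin

text \<open>
  Every part \<open>A\<close> of \<open>X\<close> leaves a closed trace on the corona. The trace is empty iff \<open>A\<close> is bounded,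
  traces of \<open>A\<close> and \<open>B\<close> are disjoint iff \<open>A\<close> and \<open>B\<close> diverge from each other, and disjoint closed
  sets of the corona are separated by traces. This turns both directions into coarse geometry.

  If \<open>X\<close> looks like \<open>\<nat>\<close> and \<open>P\<close> is a proper subcontinuum of the corona with nonempty interior, pick an
  unbounded \<open>A\<close> diverging from a part \<open>C\<close> whose trace covers \<open>P\<close>, and an unbounded \<open>V \<subseteq> C\<close> with trace
  inside \<open>P\<close>. Points of \<open>A\<close> interleaved with points of \<open>V\<close> cut \<open>C\<close> into segments, and the segments of
  even and odd index form two diverging parts that disconnect \<open>P\<close>. So the corona is indecomposable.

  Conversely, geodesics to points tending to infinity subconverge to a coarse ray. If it is not
  coarsely dense, attaching to it sparsely spaced balls of growing radius gives a set whose trace is a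
  proper subcontinuum with nonempty interior, and a continuum with such a subcontinuum is decomposable.
\<close>

section \<open>The Higson compactification\<close>

lemma mdist_self [simp]: "x \<in> mspace m \<Longrightarrow> mdist m x x = 0"
  by simp

text \<open>Non-compactness enters as unboundedness from a base point: a closed ball that fills a
  proper space would make it compact.\<close>

locale unbounded_proper_metric =
  fixes X :: "'a metric" and p0 :: 'a
  assumes proper: "proper_metric X"
    and base: "p0 \<in> mspace X"
    and unbounded: "\<And>R. \<exists>x \<in> mspace X. R < mdist X p0 x"
begin

abbreviation M where "M \<equiv> mspace X"
abbreviation d where "d \<equiv> mdist X"
abbreviation cube where "cube \<equiv> higson_cube X"
abbreviation e where "e \<equiv> higson_eval X"
abbreviation CH where "CH \<equiv> higson_functions X"
abbreviation T where "T \<equiv> higson_corona X"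

section \<open>Boundedness measured from the base point\<close>

definition bdd :: "'a set \<Rightarrow> bool" where
  "bdd S \<longleftrightarrow> (\<exists>R. \<forall>x \<in> S. d p0 x \<le> R)"

lemma bdd_subset: "bdd B \<Longrightarrow> A \<subseteq> B \<Longrightarrow> bdd A"
  unfolding bdd_def by blast

lemma bdd_Un: "bdd (A \<union> B) \<longleftrightarrow> bdd A \<and> bdd B"
proof
  assume "bdd A \<and> bdd B"
  then obtain R R' where "\<forall>x \<in> A. d p0 x \<le> R" "\<forall>x \<in> B. d p0 x \<le> R'"
    unfolding bdd_def by blast
  then have "\<forall>x \<in> A \<union> B. d p0 x \<le> max R R'" by fastforce
  then show "bdd (A \<union> B)" unfolding bdd_def by blast
qed (auto intro: bdd_subset)

lemma not_bdd_space: "\<not> bdd M"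
  using unbounded unfolding bdd_def by (meson not_less)

lemma mbounded_iff_bdd: "S \<subseteq> M \<Longrightarrow> mbounded_of X S \<longleftrightarrow> bdd S"
proof
  assume S: "S \<subseteq> M"
  assume "bdd S"
  then show "mbounded_of X S"
    unfolding bdd_def Metric_space.mbounded[OF Metric_space_mspace_mdist]
    using base S by blast
next
  assume S: "S \<subseteq> M" "mbounded_of X S"
  show "bdd S"
  proof (cases "S = {}")
    case False
    then obtain y B where y: "y \<in> M" "\<forall>x\<in>S. d y x \<le> B"
      using S unfolding Metric_space.mbounded[OF Metric_space_mspace_mdist] by blast
    have "d p0 x \<le> d p0 y + B" if "x \<in> S" for x
      using mdist_triangle[OF base y(1), of x] y(2) S(1) that by fastforce
    then show ?thesis unfolding bdd_def by blast
  qed (simp add: bdd_def)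
qed

lemma compactin_imp_bdd: "compactin (mtopology_of X) K \<Longrightarrow> bdd K"
  using Metric_space.compactin_imp_mbounded[OF Metric_space_mspace_mdist, of X K]
    mbounded_iff_bdd[of K] compactin_subset_topspace[of "mtopology_of X" K]
  by (simp add: mtopology_of_def Metric_space.topspace_mtopology[OF Metric_space_mspace_mdist])

lemma compactin_mcball: "compactin (mtopology_of X) (mcball_of X p0 R)"
  using proper base unfolding proper_metric_def by blast

text \<open>Closed balls about \<open>p0\<close> are compact, so the exceptional set may be a ball
  and the diameter condition a pairwise estimate. Asking for \<open>\<epsilon>/4\<close> from the
  centre gives \<open>\<epsilon>/2\<close> between any two points of the small ball, hence the
  strict bound.\<close>

lemma higson_functionsI:
  assumes ext: "f \<in> extensional M" and cont: "continuous_map (mtopology_of X) euclideanreal f"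
    and bound: "\<And>x. x \<in> M \<Longrightarrow> \<bar>f x\<bar> \<le> B"
    and osc: "\<And>r \<epsilon>. r > 0 \<Longrightarrow> \<epsilon> > 0 \<Longrightarrow>
      \<exists>R. \<forall>x \<in> M. \<forall>y \<in> M. R < d p0 x \<longrightarrow> d x y \<le> r \<longrightarrow> \<bar>f x - f y\<bar> \<le> \<epsilon>"
  shows "f \<in> CH"
proof -
  have "bounded (f ` M)"
    unfolding bounded_iff using bound by (intro exI[of _ B]) auto
  moreover have "\<exists>K. compactin (mtopology_of X) K \<and>
           (\<forall>x \<in> M - K. diameter (f ` mcball_of X x r) < \<epsilon>)" if "r > 0" "\<epsilon> > 0" for r \<epsilon>
  proof -
    obtain R where R: "\<forall>x \<in> M. \<forall>y \<in> M. R < d p0 x \<longrightarrow> d x y \<le> r \<longrightarrow> \<bar>f x - f y\<bar> \<le> \<epsilon>/4"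
      using osc[of r "\<epsilon>/4"] \<open>r > 0\<close> \<open>\<epsilon> > 0\<close> by auto
    have "diameter (f ` mcball_of X x r) < \<epsilon>" if "x \<in> M - mcball_of X p0 R" for x
    proof -
      have "diameter (f ` mcball_of X x r) \<le> \<epsilon>/2"
      proof (rule diameter_le)
        fix u v assume "u \<in> f ` mcball_of X x r" "v \<in> f ` mcball_of X x r"
        then obtain y z where yz: "y \<in> M" "z \<in> M" "d x y \<le> r" "d x z \<le> r" "u = f y" "v = f z"
          by auto
        have "R < d p0 x" "x \<in> M" using that base by auto
        then have "\<bar>f x - f y\<bar> \<le> \<epsilon>/4" "\<bar>f x - f z\<bar> \<le> \<epsilon>/4" using R yz by blast+
        then have "\<bar>f y - f z\<bar> \<le> \<epsilon>/2" by linarith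
        then show "norm (u - v) \<le> \<epsilon>/2" by (simp add: yz)
      qed (use \<open>\<epsilon> > 0\<close> in simp)
      with \<open>\<epsilon> > 0\<close> show ?thesis by simp
    qed
    then show ?thesis using compactin_mcball by blast
  qed
  ultimately show ?thesis using ext cont unfolding higson_functions_def by blast
qed

text \<open>Compact sets are bounded, so a radius replaces \<open>K\<close>; only the first point
  has to be far out. Boundedness of \<open>f\<close> lets the diameter dominate a difference of
  values.\<close>

lemma higson_functions_osc:
  assumes f: "f \<in> CH" and "r > 0" "\<epsilon> > 0"
  obtains R where "\<And>x y. x \<in> M \<Longrightarrow> y \<in> M \<Longrightarrow> R < d p0 x \<Longrightarrow> d x y \<le> r \<Longrightarrow> \<bar>f x - f y\<bar> < \<epsilon>"
proof -
  obtain K where K: "compactin (mtopology_of X) K"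
    "\<forall>x \<in> M - K. diameter (f ` mcball_of X x r) < \<epsilon>"
    using f \<open>r > 0\<close> \<open>\<epsilon> > 0\<close> unfolding higson_functions_def by blast
  obtain R where R: "\<forall>x \<in> K. d p0 x \<le> R" using compactin_imp_bdd[OF K(1)] unfolding bdd_def by blast
  have "\<bar>f x - f y\<bar> < \<epsilon>" if "x \<in> M" "y \<in> M" "R < d p0 x" "d x y \<le> r" for x y
  proof -
    have "bounded (f ` M)" using f unfolding higson_functions_def by blast
    then have b: "bounded (f ` mcball_of X x r)" by (rule bounded_subset) auto
    have "x \<in> mcball_of X x r" "y \<in> mcball_of X x r" using that \<open>r > 0\<close> by auto
    then have "f x \<in> f ` mcball_of X x r" "f y \<in> f ` mcball_of X x r" by blast+
    from diameter_bounded_bound[OF b this] have "\<bar>f x - f y\<bar> \<le> diameter (f ` mcball_of X x r)"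
      by (simp add: dist_real_def)
    moreover have "x \<in> M - K" using that R by auto
    ultimately show ?thesis using K(2) by (meson le_less_trans)
  qed
  then show ?thesis using that by blast
qed

section \<open>The cube and the evaluation map\<close>

lemma higson_functions_range:
  assumes "f \<in> CH" "x \<in> M"
  shows "f x \<in> {Inf (f ` M)..Sup (f ` M)}"
proof -
  have "bounded (f ` M)" using assms unfolding higson_functions_def by blast
  then have "bdd_above (f ` M)" "bdd_below (f ` M)"
    by (simp_all add: bounded_imp_bdd_above bounded_imp_bdd_below)
  with assms show ?thesis by (auto intro: cINF_lower cSUP_upper)
qed

lemma compact_cube: "compact_space cube"
  unfolding higson_cube_def compact_space_product_topology by (simp add: compact_space_def)

lemma Hausdorff_cube: "Hausdorff_space cube"
  unfolding higson_cube_def Hausdorff_space_product_topology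
  by (auto intro!: Hausdorff_space_subtopology)

lemma topspace_cube: "topspace cube = (\<Pi>\<^sub>E f\<in>CH. {Inf (f ` M)..Sup (f ` M)})"
  by (simp add: higson_cube_def)

lemma eval_in_cube: "x \<in> M \<Longrightarrow> e x \<in> topspace cube"
  unfolding topspace_cube higson_eval_def using higson_functions_range by auto

lemma eval_image_subset: "A \<subseteq> M \<Longrightarrow> e ` A \<subseteq> topspace cube"
  using eval_in_cube by blast

lemma eval_apply [simp]: "f \<in> CH \<Longrightarrow> e x f = f x"
  by (simp add: higson_eval_def)

lemma continuous_map_eval: "continuous_map (mtopology_of X) cube e"
  unfolding higson_cube_def continuous_map_componentwise
proof (intro conjI ballI)
  show "e ` topspace (mtopology_of X) \<subseteq> extensional CH" by (auto simp: higson_eval_def)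
  fix f assume f: "f \<in> CH"
  then have "continuous_map (mtopology_of X) (top_of_set {Inf (f ` M)..Sup (f ` M)}) f"
    using higson_functions_range[OF f]
    by (auto simp: continuous_map_in_subtopology higson_functions_def)
  then show "continuous_map (mtopology_of X) (top_of_set {Inf (f ` M)..Sup (f ` M)}) (\<lambda>x. e x f)"
    using f by simp
qed

text \<open>Basic open sets of the product constrain finitely many coordinates, each up to some
  positive error. Closures thus turn into simultaneous approximation of finitely many Higson
  functions at one point of \<open>A\<close>.\<close>

lemma closure_eval_iff:
  assumes "A \<subseteq> M"
  shows "p \<in> cube closure_of (e ` A) \<longleftrightarrow> p \<in> topspace cube \<and>
    (\<forall>I \<epsilon>. finite I \<longrightarrow> I \<subseteq> CH \<longrightarrow> \<epsilon> > 0 \<longrightarrow> (\<exists>x \<in> A. \<forall>f \<in> I. \<bar>f x - p f\<bar> < \<epsilon>))"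
    (is "_ \<longleftrightarrow> _ \<and> ?R")
proof (intro iffI conjI allI impI)
  assume p: "p \<in> cube closure_of (e ` A)"
  then show pc: "p \<in> topspace cube" by (meson in_closure_of)
  fix I :: "('a \<Rightarrow> real) set" and \<epsilon> :: real assume I: "finite I" "I \<subseteq> CH" "\<epsilon> > 0"
  define U where "U = {q \<in> topspace cube. \<forall>f \<in> I. q f \<in> ball (p f) \<epsilon>}"
  have "openin cube {q \<in> topspace cube. q f \<in> ball (p f) \<epsilon>}" if "f \<in> I" for f
  proof -
    have "continuous_map cube (top_of_set {Inf (f ` M)..Sup (f ` M)}) (\<lambda>q. q f)"
      unfolding higson_cube_def
      by (rule continuous_map_product_projection) (use I that in auto)
    then have "continuous_map cube euclideanreal (\<lambda>q. q f)"
      using continuous_map_in_subtopology by blast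
    then show ?thesis by (rule openin_continuous_map_preimage) simp
  qed
  then have "openin cube (topspace cube \<inter> (\<Inter>f \<in> I. {q \<in> topspace cube. q f \<in> ball (p f) \<epsilon>}))"
    using I by (auto intro!: openin_Int_Inter)
  moreover have "topspace cube \<inter> (\<Inter>f \<in> I. {q \<in> topspace cube. q f \<in> ball (p f) \<epsilon>}) = U"
    unfolding U_def by auto
  ultimately have "openin cube U" by simp
  moreover have "p \<in> U" using pc I by (simp add: U_def)
  ultimately obtain x where "x \<in> A" "e x \<in> U"
    using p unfolding in_closure_of by blast
  then have "\<forall>f \<in> I. \<bar>f x - p f\<bar> < \<epsilon>"
    using I(2) by (auto simp: U_def dist_real_def subset_iff abs_minus_commute)
  with \<open>x \<in> A\<close> show "\<exists>x \<in> A. \<forall>f \<in> I. \<bar>f x - p f\<bar> < \<epsilon>" by blast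
next
  assume p: "p \<in> topspace cube \<and> ?R"
  show "p \<in> cube closure_of (e ` A)"
    unfolding in_closure_of
  proof (intro conjI allI impI)
    fix W assume W: "p \<in> W \<and> openin cube W"
    then obtain U where U: "finite {f \<in> CH. U f \<noteq> {Inf (f ` M)..Sup (f ` M)}}"
      "\<forall>f \<in> CH. openin (top_of_set {Inf (f ` M)..Sup (f ` M)}) (U f)"
      "p \<in> Pi\<^sub>E CH U" "Pi\<^sub>E CH U \<subseteq> W"
      unfolding higson_cube_def openin_product_topology_alt by fastforce
    define I where "I = {f \<in> CH. U f \<noteq> {Inf (f ` M)..Sup (f ` M)}}"
    have "\<exists>\<epsilon>>0. {Inf (f ` M)..Sup (f ` M)} \<inter> ball (p f) \<epsilon> \<subseteq> U f" if "f \<in> CH" for f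
    proof -
      have "openin (top_of_set {Inf (f ` M)..Sup (f ` M)}) (U f)" "p f \<in> U f"
        using U that by auto
      then show ?thesis unfolding openin_contains_ball by (metis inf_commute)
    qed
    then obtain \<delta> where \<delta>: "\<And>f. f \<in> CH \<Longrightarrow> \<delta> f > 0 \<and> {Inf (f ` M)..Sup (f ` M)} \<inter> ball (p f) (\<delta> f) \<subseteq> U f"
      by metis
    \<comment> \<open>The inserted 1 keeps the minimum meaningful when no coordinate is
      constrained.\<close>
    define \<epsilon> where "\<epsilon> = Min (insert 1 (\<delta> ` I))"
    have fin: "finite I" using U(1) by (simp add: I_def)
    have "\<epsilon> > 0" unfolding \<epsilon>_def using fin \<delta> by (auto simp: I_def)
    moreover have "I \<subseteq> CH" by (auto simp: I_def)
    ultimately obtain x where x: "x \<in> A" "\<forall>f \<in> I. \<bar>f x - p f\<bar> < \<epsilon>"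
      using p fin by blast
    have "e x f \<in> U f" if f: "f \<in> CH" for f
    proof (cases "f \<in> I")
      case True
      have "\<epsilon> \<le> \<delta> f" unfolding \<epsilon>_def using fin True by auto
      then have "f x \<in> ball (p f) (\<delta> f)" using x(2) True by (force simp: dist_real_def)
      moreover have "f x \<in> {Inf (f ` M)..Sup (f ` M)}"
        using higson_functions_range[OF f] x(1) assms by blast
      ultimately have "f x \<in> U f" using \<delta>[OF f] by blast
      then show ?thesis using f by simp
    next
      case False
      then have "U f = {Inf (f ` M)..Sup (f ` M)}" using f by (simp add: I_def)
      then show ?thesis using f higson_functions_range[OF f, of x] x(1) assms by auto
    qed
    then have "e x \<in> Pi\<^sub>E CH U" by (auto simp: higson_eval_def)
    then show "\<exists>y. y \<in> e ` A \<and> y \<in> W" using U(4) x(1) by blast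
  qed (use p in blast)
qed

section \<open>Higson functions that separate points from infinity\<close>

lemma Lipschitz_imp_continuous:
  assumes "\<And>x y. x \<in> M \<Longrightarrow> y \<in> M \<Longrightarrow> \<bar>f x - f y\<bar> \<le> d x y"
  shows "continuous_map (mtopology_of X) euclideanreal f"
proof -
  have "Lipschitz_continuous_map X euclidean_metric f"
    unfolding Lipschitz_continuous_map_def
    using assms by (auto simp: dist_real_def intro!: exI[of _ 1])
  then show ?thesis
    using Lipschitz_continuous_imp_continuous_map by fastforce
qed

lemma mdist_diff_le: "x \<in> M \<Longrightarrow> y \<in> M \<Longrightarrow> a \<in> M \<Longrightarrow> \<bar>d a x - d a y\<bar> \<le> d x y"
  using mdist_triangle[of a X x y] mdist_triangle[of a X y x] mdist_commute[of X x y] by linarith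

text \<open>A tent of height 1 at \<open>a\<close> that vanishes outside the unit ball; it keeps
  \<open>e a\<close> away from the images of all distant points.\<close>

definition bump :: "'a \<Rightarrow> 'a \<Rightarrow> real" where
  "bump a = (\<lambda>x \<in> M. max 0 (1 - d a x))"

lemma bump_in_CH:
  assumes "a \<in> M"
  shows "bump a \<in> CH"
proof (rule higson_functionsI)
  show "continuous_map (mtopology_of X) euclideanreal (bump a)"
  proof (rule Lipschitz_imp_continuous)
    show "\<bar>bump a x - bump a y\<bar> \<le> d x y" if "x \<in> M" "y \<in> M" for x y
      using mdist_diff_le[OF that assms] that by (simp add: bump_def)
  qed
  show "\<bar>bump a x\<bar> \<le> 1" if "x \<in> M" for x using that by (simp add: bump_def)
  fix r \<epsilon> :: real assume "r > 0" "\<epsilon> > 0"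
  have "bump a x = 0 \<and> bump a y = 0"
    if "x \<in> M" "y \<in> M" "d p0 a + 1 + r < d p0 x" "d x y \<le> r" for x y
    using mdist_triangle[OF base assms that(1)] mdist_triangle[OF assms that(2,1)] that \<open>r > 0\<close>
    by (simp add: bump_def mdist_commute)
  then show "\<exists>R. \<forall>x \<in> M. \<forall>y \<in> M. R < d p0 x \<longrightarrow> d x y \<le> r \<longrightarrow> \<bar>bump a x - bump a y\<bar> \<le> \<epsilon>"
    using \<open>\<epsilon> > 0\<close> by (intro exI[of _ "d p0 a + 1 + r"]) simp
qed (simp add: bump_def)

lemma topspace_corona: "topspace T = cube closure_of (e ` M) - e ` M"
  using closure_of_subset_topspace[of cube "e ` M"]
  by (auto simp: higson_corona_def higson_compactification_def)

text \<open>The nested subtopologies collapse, so compactness and the Hausdorff property can be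
  inherited from the cube.\<close>

lemma corona_eq: "T = subtopology cube (topspace T)"
proof -
  have "T = subtopology cube (cube closure_of (e ` M) \<inter> (topspace (higson_compactification X) - e ` M))"
    unfolding higson_corona_def higson_compactification_def by (simp add: subtopology_subtopology)
  also have "cube closure_of (e ` M) \<inter> (topspace (higson_compactification X) - e ` M) = topspace T"
    unfolding topspace_corona using closure_of_subset_topspace[of cube "e ` M"]
    by (auto simp: higson_compactification_def)
  finally show ?thesis .
qed

section \<open>Traces on the corona\<close>

definition trace :: "'a set \<Rightarrow> (('a \<Rightarrow> real) \<Rightarrow> real) set" where
  "trace A = cube closure_of (e ` A) \<inter> topspace T"

text \<open>Points of \<open>A\<close> in a ball contribute nothing to the corona, because the image
  of the ball is compact, hence closed, and consists of evaluations. Conversely, a point in the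
  closure of every tail cannot be some \<open>e a\<close>, since \<open>bump a\<close> is 1 at
  \<open>a\<close> and 0 on a tail.\<close>

lemma trace_iff:
  assumes A: "A \<subseteq> M"
  shows "p \<in> trace A \<longleftrightarrow> (\<forall>R. p \<in> cube closure_of (e ` {x \<in> A. R < d p0 x}))"
proof (intro iffI allI)
  fix R assume p: "p \<in> trace A"
  let ?N = "{x \<in> A. d p0 x \<le> R}" and ?F = "{x \<in> A. R < d p0 x}"
  have "compactin cube (e ` mcball_of X p0 R)"
    using compactin_mcball continuous_map_eval by (rule image_compactin)
  then have "closedin cube (e ` mcball_of X p0 R)"
    by (rule compactin_imp_closedin[OF Hausdorff_cube])
  moreover have "e ` ?N \<subseteq> e ` mcball_of X p0 R" using A base by auto
  ultimately have "cube closure_of (e ` ?N) \<subseteq> e ` mcball_of X p0 R"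
    by (rule closure_of_minimal[rotated])
  then have "cube closure_of (e ` ?N) \<subseteq> e ` M" by auto
  moreover have "e ` A = e ` ?N \<union> e ` ?F" by force
  ultimately show "p \<in> cube closure_of (e ` ?F)"
    using p unfolding trace_def topspace_corona by auto
next
  assume p: "\<forall>R. p \<in> cube closure_of (e ` {x \<in> A. R < d p0 x})"
  have "p \<noteq> e a" if a: "a \<in> M" for a
  proof
    assume "p = e a"
    let ?F = "{x \<in> A. d p0 a + 1 < d p0 x}"
    have "p \<in> cube closure_of (e ` ?F)" using p by blast
    moreover have "?F \<subseteq> M" using A by blast
    ultimately have "\<forall>I \<epsilon>. finite I \<longrightarrow> I \<subseteq> CH \<longrightarrow> \<epsilon> > 0 \<longrightarrow> (\<exists>x \<in> ?F. \<forall>f \<in> I. \<bar>f x - p f\<bar> < \<epsilon>)"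
      using closure_eval_iff by blast
    from this[rule_format, of "{bump a}" 1] obtain x where
      x: "x \<in> A" "d p0 a + 1 < d p0 x" "\<bar>bump a x - p (bump a)\<bar> < 1"
      using bump_in_CH[OF a] by auto
    then have "d a x > 1" using mdist_triangle[OF base a, of x] A by auto
    then show False using x A bump_in_CH[OF a] a \<open>p = e a\<close> by (auto simp: bump_def)
  qed
  moreover have "p \<in> cube closure_of (e ` A)"
    using closure_of_mono[of "e ` {x \<in> A. 0 < d p0 x}" "e ` A" cube] p by blast
  ultimately show "p \<in> trace A"
    unfolding trace_def topspace_corona using closure_of_mono[of "e ` A" "e ` M" cube] A by blast
qed

lemma trace_space: "trace M = topspace T"
  unfolding trace_def topspace_corona by blast

text \<open>Applied to the whole space, \<open>trace_iff\<close> exhibits the corona as an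
  intersection of closures.\<close>

lemma closedin_corona: "closedin cube (topspace T)"
proof -
  have "topspace T = (\<Inter>R. cube closure_of (e ` {x \<in> M. R < d p0 x}))"
    using trace_iff[of M] unfolding trace_space by blast
  then show ?thesis by auto
qed

lemma closedin_corona_iff: "closedin T F \<longleftrightarrow> closedin cube F \<and> F \<subseteq> topspace T"
  using closedin_closed_subtopology[OF closedin_corona] corona_eq by simp

lemma trace_subset: "trace A \<subseteq> topspace T"
  unfolding trace_def by blast

lemma closedin_trace: "closedin T (trace A)"
  unfolding closedin_corona_iff trace_def by (simp add: closedin_Int closedin_corona)

lemma compact_corona: "compact_space T"
  using closedin_compact_space[OF compact_cube closedin_corona] corona_eq
  by (metis compact_space_subtopology)

lemma Hausdorff_corona: "Hausdorff_space T"
  using Hausdorff_space_subtopology[OF Hausdorff_cube] corona_eq by metis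

lemma trace_Un: "trace (A \<union> B) = trace A \<union> trace B"
  unfolding trace_def image_Un closure_of_Un by blast

lemma trace_mono: "A \<subseteq> B \<Longrightarrow> trace A \<subseteq> trace B"
  unfolding trace_def using closure_of_mono[of "e ` A" "e ` B" cube] by blast

text \<open>The tails of an unbounded set are nonempty, and their closures form a decreasing
  sequence of closed sets in the compact cube, so they have a common point.\<close>

lemma trace_empty_iff:
  assumes A: "A \<subseteq> M"
  shows "trace A = {} \<longleftrightarrow> bdd A"
proof
  assume "bdd A"
  then obtain R where "\<forall>x \<in> A. d p0 x \<le> R" unfolding bdd_def by blast
  then have "e ` {x \<in> A. R < d p0 x} = {}" by force
  then have "p \<notin> trace A" for p
    using trace_iff[OF A, of p] closure_of_empty[of cube] by (metis empty_iff)
  then show "trace A = {}" by blast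
next
  assume tr: "trace A = {}"
  show "bdd A"
  proof (rule ccontr)
    assume unb: "\<not> bdd A"
    let ?C = "\<lambda>n::nat. cube closure_of (e ` {x \<in> A. real n < d p0 x})"
    have "(\<Inter>n. ?C n) \<noteq> {}"
    proof (rule compact_space_imp_nest[OF compact_cube])
      fix n :: nat
      obtain x where "x \<in> A" "real n < d p0 x" using unb unfolding bdd_def by (meson not_less)
      moreover have "e ` {x \<in> A. real n < d p0 x} \<subseteq> topspace cube"
        using A by (intro eval_image_subset) auto
      ultimately show "?C n \<noteq> {}" using closure_of_subset by blast
    next
      show "decseq ?C"
        by (intro decseq_SucI closure_of_mono image_mono) auto
    qed auto
    then obtain p where p: "\<And>n. p \<in> ?C n" by blast
    have "p \<in> cube closure_of (e ` {x \<in> A. R < d p0 x})" for R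
    proof -
      obtain n :: nat where "R \<le> real n" using real_arch_simple by blast
      then have "e ` {x \<in> A. real n < d p0 x} \<subseteq> e ` {x \<in> A. R < d p0 x}" by force
      then show ?thesis using p[of n] closure_of_mono by blast
    qed
    then show False using tr trace_iff[OF A] by blast
  qed
qed

text \<open>Far out, a Higson function hardly changes between a point of \<open>S\<close> and a
  point of \<open>A\<close> within \<open>r\<close> of it, so one can replace the other in an
  approximation of \<open>p\<close>.\<close>

lemma trace_enlarge:
  assumes S: "S \<subseteq> M" and A: "A \<subseteq> M" and r: "\<And>x. x \<in> S \<Longrightarrow> \<exists>a \<in> A. d x a \<le> r"
  shows "trace S \<subseteq> trace A"
proof
  fix p assume p: "p \<in> trace S"
  have "p \<in> cube closure_of (e ` A)"
    unfolding closure_eval_iff[OF A]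
  proof (intro conjI allI impI)
    show "p \<in> topspace cube" using p unfolding trace_def by (meson IntD1 in_closure_of)
    fix I :: "('a \<Rightarrow> real) set" and \<epsilon> :: real assume I: "finite I" "I \<subseteq> CH" "\<epsilon> > 0"
    \<comment> \<open>The maximum with 1 supplies the positive radius that the oscillation condition
      asks for.\<close>
    have "\<exists>R. \<forall>x \<in> M. \<forall>y \<in> M. R < d p0 x \<longrightarrow> d x y \<le> max r 1 \<longrightarrow> \<bar>f x - f y\<bar> < \<epsilon>/2" if "f \<in> I" for f
    proof -
      have "f \<in> CH" "max r 1 > 0" "\<epsilon>/2 > 0" using I that by auto
      then show ?thesis by (rule higson_functions_osc) blast
    qed
    then obtain R where R: "\<And>f x y. f \<in> I \<Longrightarrow> x \<in> M \<Longrightarrow> y \<in> M \<Longrightarrow> R f < d p0 x \<Longrightarrow>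
      d x y \<le> max r 1 \<Longrightarrow> \<bar>f x - f y\<bar> < \<epsilon>/2" by metis
    define Q where "Q = Max (insert 0 (R ` I))"
    have Q: "R f \<le> Q" if "f \<in> I" for f using that I(1) by (simp add: Q_def)
    have "p \<in> cube closure_of (e ` {x \<in> S. Q < d p0 x})" using p trace_iff[OF S] by blast
    moreover have "{x \<in> S. Q < d p0 x} \<subseteq> M" using S by blast
    ultimately obtain x where x: "x \<in> S" "Q < d p0 x" "\<forall>f \<in> I. \<bar>f x - p f\<bar> < \<epsilon>/2"
      using closure_eval_iff[of "{x \<in> S. Q < d p0 x}"] I half_gt_zero[OF \<open>\<epsilon> > 0\<close>] by blast
    obtain a where a: "a \<in> A" "d x a \<le> r" using r x by blast
    have "\<bar>f a - p f\<bar> < \<epsilon>" if "f \<in> I" for f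
    proof -
      have "\<bar>f x - f a\<bar> < \<epsilon>/2"
        by (rule R) (use that a x S A Q[OF that] in auto)
      then show ?thesis using x(3) that by (smt (verit) field_sum_of_halves)
    qed
    then show "\<exists>a \<in> A. \<forall>f \<in> I. \<bar>f a - p f\<bar> < \<epsilon>" using a by blast
  qed
  then show "p \<in> trace A" using p unfolding trace_def by blast
qed

section \<open>Divergence of sets and disjointness of traces\<close>

definition coarsely_disjoint :: "'a set \<Rightarrow> 'a set \<Rightarrow> bool" where
  "coarsely_disjoint A B \<longleftrightarrow> (\<forall>r. bdd {a \<in> A. \<exists>b \<in> B. d a b \<le> r})"

definition set_dist :: "'a set \<Rightarrow> 'a \<Rightarrow> real" where
  "set_dist A x = (INF a\<in>A. d x a)"

lemma set_dist_le: "a \<in> A \<Longrightarrow> set_dist A x \<le> d x a"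
  unfolding set_dist_def by (rule cINF_lower) (auto intro: bdd_belowI[of _ 0])

lemma set_dist_nonneg: "A \<noteq> {} \<Longrightarrow> 0 \<le> set_dist A x"
  unfolding set_dist_def by (rule cINF_greatest) auto

lemma set_dist_approx:
  assumes "A \<noteq> {}"
  obtains a where "a \<in> A" "d x a < set_dist A x + 1"
proof -
  have "(INF a\<in>A. d x a) < set_dist A x + 1" by (simp add: set_dist_def)
  then show ?thesis using that assms
    by (subst (asm) cINF_less_iff) (auto intro: bdd_belowI[of _ 0])
qed

lemma set_dist_Lipschitz:
  assumes "A \<noteq> {}" "A \<subseteq> M" "x \<in> M" "y \<in> M"
  shows "\<bar>set_dist A x - set_dist A y\<bar> \<le> d x y"
proof -
  have "set_dist A x \<le> set_dist A y + d x y" if "x \<in> M" "y \<in> M" for x y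
  proof -
    have "set_dist A x - d x y \<le> d y a" if a: "a \<in> A" for a
      using set_dist_le[OF a, of x] mdist_triangle[of x X y a] assms a \<open>x \<in> M\<close> \<open>y \<in> M\<close> by fastforce
    then have "set_dist A x - d x y \<le> set_dist A y"
      unfolding set_dist_def[of A y] using assms by (intro cINF_greatest) auto
    then show ?thesis by simp
  qed
  from this[of x y] this[of y x] show ?thesis using assms mdist_commute[of X x y] by fastforce
qed

text \<open>With \<open>a\<close>, \<open>b\<close> the distances to \<open>A\<close>, \<open>B\<close>, the quotient \<open>a / (a + b + 1)\<close> is continuous
  everywhere and varies by at most \<open>r / (a + b + 1)\<close> on balls of radius \<open>r\<close>.\<close>

lemma trace_disjoint_if_coarsely_disjoint:
  assumes A: "A \<subseteq> M" and B: "B \<subseteq> M" and AB: "coarsely_disjoint A B"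
  shows "trace A \<inter> trace B = {}"
proof (cases "A = {} \<or> B = {}")
  case True
  then show ?thesis using trace_empty_iff[of "{}"] by (auto simp: bdd_def)
next
  case False
  then have ne: "A \<noteq> {}" "B \<noteq> {}" by auto
  define a where "a = set_dist A"
  define b where "b = set_dist B"
  have nn: "0 \<le> a x" "0 \<le> b x" for x
    using ne set_dist_nonneg by (auto simp: a_def b_def)
  have lip: "\<bar>a x - a y\<bar> \<le> d x y" "\<bar>b x - b y\<bar> \<le> d x y" if "x \<in> M" "y \<in> M" for x y
    unfolding a_def b_def using set_dist_Lipschitz ne A B that by blast+
  \<comment> \<open>A point with \<open>a x + b x\<close> at most \<open>Q\<close> lies within
    \<open>Q + 1\<close> of a point of \<open>A\<close> that is within \<open>2 * Q + 2\<close> of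
    \<open>B\<close>; divergence confines such points to a ball.\<close>
  have far: "\<exists>R. \<forall>x \<in> M. R < d p0 x \<longrightarrow> Q < a x + b x" for Q
  proof -
    obtain R where R: "\<forall>x \<in> {a \<in> A. \<exists>b \<in> B. d a b \<le> 2 * Q + 2}. d p0 x \<le> R"
      using AB unfolding coarsely_disjoint_def bdd_def by blast
    have "Q < a x + b x" if x: "x \<in> M" "R + Q + 1 < d p0 x" for x
    proof (rule ccontr)
      assume "\<not> Q < a x + b x"
      obtain u where u: "u \<in> A" "d x u < a x + 1" using set_dist_approx ne(1) unfolding a_def by blast
      obtain v where v: "v \<in> B" "d x v < b x + 1" using set_dist_approx ne(2) unfolding b_def by blast
      have uv: "u \<in> M" "v \<in> M" using u v A B by auto
      have "d u v \<le> 2 * Q + 2"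
        using mdist_triangle[OF uv(1) x(1) uv(2)] mdist_commute[of X u x] u v nn[of x] \<open>\<not> Q < a x + b x\<close>
        by linarith
      then have "d p0 u \<le> R" using R u v by blast
      then show False
        using mdist_triangle[OF base uv(1) x(1)] mdist_commute[of X u x] u x nn[of x] \<open>\<not> Q < a x + b x\<close>
        by linarith
    qed
    then show ?thesis by blast
  qed
  define \<phi> where "\<phi> = (\<lambda>x \<in> M. a x / (a x + b x + 1))"
  have pos: "0 < a x + b x + 1" for x using nn[of x] by linarith
  have "\<phi> \<in> CH"
  proof (rule higson_functionsI)
    have "continuous_map (mtopology_of X) euclideanreal a"
      "continuous_map (mtopology_of X) euclideanreal b"
      using lip Lipschitz_imp_continuous by blast+
    then have "continuous_map (mtopology_of X) euclideanreal (\<lambda>x. a x / (a x + b x + 1))"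
      using pos by (intro continuous_intros) (auto simp: less_imp_neq[symmetric])
    then show "continuous_map (mtopology_of X) euclideanreal \<phi>"
      by (rule continuous_map_eq) (simp add: \<phi>_def)
    show "\<bar>\<phi> x\<bar> \<le> 1" if "x \<in> M" for x
      using that nn[of x] pos[of x] by (simp add: \<phi>_def)
    fix r \<epsilon> :: real assume re: "r > 0" "\<epsilon> > 0"
    obtain R where R: "\<forall>x \<in> M. R < d p0 x \<longrightarrow> r / \<epsilon> < a x + b x" using far by blast
    have "\<bar>\<phi> x - \<phi> y\<bar> \<le> \<epsilon>" if xy: "x \<in> M" "y \<in> M" "R < d p0 x" "d x y \<le> r" for x y
    proof -
      let ?s = "a x + b x + 1" and ?t = "a y + b y + 1"
      have "\<phi> x - \<phi> y = (a x * ?t - a y * ?s) / (?s * ?t)"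
        using pos[of x] pos[of y] xy by (simp add: \<phi>_def diff_frac_eq)
      \<comment> \<open>Each summand now carries a difference bounded by \<open>r\<close>, and the
        remaining factors add up to \<open>?t\<close>, which cancels.\<close>
      also have "a x * ?t - a y * ?s = (a x - a y) * (b y + 1) + a y * (b y - b x)"
        by (simp add: algebra_simps)
      finally have "\<bar>\<phi> x - \<phi> y\<bar> = \<bar>(a x - a y) * (b y + 1) + a y * (b y - b x)\<bar> / (?s * ?t)"
        using pos[of x] pos[of y] by (simp add: abs_mult)
      also have "\<dots> \<le> (r * (b y + 1) + a y * r) / (?s * ?t)"
      proof (rule divide_right_mono)
        have "\<bar>(a x - a y) * (b y + 1)\<bar> \<le> r * (b y + 1)"
          unfolding abs_mult using lip(1)[OF xy(1,2)] xy(4) nn[of y] by (intro mult_mono) auto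
        moreover have "\<bar>a y * (b y - b x)\<bar> \<le> a y * r"
          unfolding abs_mult using lip(2)[OF xy(1,2)] xy(4) nn[of y] by (intro mult_mono) auto
        ultimately show "\<bar>(a x - a y) * (b y + 1) + a y * (b y - b x)\<bar> \<le> r * (b y + 1) + a y * r"
          by linarith
        show "0 \<le> ?s * ?t" using pos[of x] pos[of y] by simp
      qed
      also have "r * (b y + 1) + a y * r = r * ?t" by (simp add: algebra_simps)
      also have "r * ?t / (?s * ?t) = r / ?s" using pos[of y] by simp
      also have "\<dots> \<le> \<epsilon>"
      proof -
        have "r / \<epsilon> < ?s" using R xy by force
        then show ?thesis using pos[of x] re by (simp add: field_simps)
      qed
      finally show ?thesis .
    qed
    then show "\<exists>R. \<forall>x \<in> M. \<forall>y \<in> M. R < d p0 x \<longrightarrow> d x y \<le> r \<longrightarrow> \<bar>\<phi> x - \<phi> y\<bar> \<le> \<epsilon>" by blast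
  qed (simp add: \<phi>_def)
  have zA: "a x = 0" if "x \<in> A" for x
    using set_dist_le[OF that, of x] nn[of x] that A unfolding a_def by fastforce
  have zB: "b x = 0" if "x \<in> B" for x
    using set_dist_le[OF that, of x] nn[of x] that B unfolding b_def by fastforce
  show ?thesis
  proof (rule ccontr)
    assume "trace A \<inter> trace B \<noteq> {}"
    then obtain p where p: "p \<in> trace A" "p \<in> trace B" by blast
    \<comment> \<open>Beyond \<open>R\<close> the function is 0 on \<open>A\<close> and at least 1/2
      on \<open>B\<close>, so no value is within 1/4 of both.\<close>
    obtain R where R: "\<forall>x \<in> M. R < d p0 x \<longrightarrow> 1 < a x + b x" using far by blast
    have near: "\<exists>x \<in> S. R < d p0 x \<and> \<bar>\<phi> x - p \<phi>\<bar> < 1/4" if "p \<in> trace S" "S \<subseteq> M" for S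
    proof -
      have "p \<in> cube closure_of (e ` {x \<in> S. R < d p0 x})" using that trace_iff by blast
      moreover have "{x \<in> S. R < d p0 x} \<subseteq> M" using that by blast
      ultimately have "\<forall>I \<epsilon>. finite I \<longrightarrow> I \<subseteq> CH \<longrightarrow> \<epsilon> > 0 \<longrightarrow>
        (\<exists>x \<in> {x \<in> S. R < d p0 x}. \<forall>f \<in> I. \<bar>f x - p f\<bar> < \<epsilon>)"
        using closure_eval_iff by blast
      from this[rule_format, of "{\<phi>}" "1/4"] show ?thesis using \<open>\<phi> \<in> CH\<close> by auto
    qed
    obtain x where x: "x \<in> A" "\<bar>\<phi> x - p \<phi>\<bar> < 1/4" using near[OF p(1) A] by blast
    obtain y where y: "y \<in> B" "R < d p0 y" "\<bar>\<phi> y - p \<phi>\<bar> < 1/4" using near[OF p(2) B] by blast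
    have "\<phi> x = 0" using zA x A by (auto simp: \<phi>_def)
    moreover have "\<phi> y \<ge> 1/2"
      using zB[OF y(1)] R y B by (auto simp: \<phi>_def field_simps)
    ultimately show False using x y by linarith
  qed
qed

text \<open>For the direction still open, the points of \<open>A\<close> within \<open>r\<close> of
  \<open>B\<close> have their trace in both traces, by \<open>trace_enlarge\<close>; an empty trace
  means that they are bounded.\<close>

lemma trace_disjoint_iff:
  assumes A: "A \<subseteq> M" and B: "B \<subseteq> M"
  shows "trace A \<inter> trace B = {} \<longleftrightarrow> coarsely_disjoint A B"
proof
  assume tr: "trace A \<inter> trace B = {}"
  show "coarsely_disjoint A B"
    unfolding coarsely_disjoint_def
  proof
    fix r
    let ?S = "{a \<in> A. \<exists>b \<in> B. d a b \<le> r}"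
    have "trace ?S \<subseteq> trace A" by (rule trace_mono) auto
    moreover have "trace ?S \<subseteq> trace B" by (rule trace_enlarge[where r = r]) (use A B in auto)
    ultimately show "bdd ?S" using tr trace_empty_iff[of ?S] A by blast
  qed
qed (rule trace_disjoint_if_coarsely_disjoint[OF A B])

text \<open>The compact Hausdorff cube is normal. Disjoint open neighbourhoods \<open>U\<close>,
  \<open>V\<close> of the two closed sets give the parts of the space whose images avoid
  \<open>U\<close>, respectively \<open>V\<close>; closures of these images still avoid
  them.\<close>

lemma corona_separation:
  assumes "closedin T F" "closedin T G" "F \<inter> G = {}"
  obtains A B where "A \<subseteq> M" "B \<subseteq> M" "A \<union> B = M" "trace A \<inter> F = {}" "trace B \<inter> G = {}"
proof -
  have "closedin cube F" "closedin cube G" "disjnt F G"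
    using assms closedin_corona_iff by (auto simp: disjnt_def)
  moreover have "normal_space cube"
    using compact_Hausdorff_or_regular_imp_normal_space compact_cube Hausdorff_cube by blast
  ultimately have "\<exists>U V. openin cube U \<and> openin cube V \<and> F \<subseteq> U \<and> G \<subseteq> V \<and> disjnt U V"
    unfolding normal_space_def by simp
  then obtain U V where UV: "openin cube U" "openin cube V" "F \<subseteq> U" "G \<subseteq> V" "disjnt U V"
    by blast
  have tr: "trace {x \<in> M. e x \<notin> W} \<inter> W = {}" if "openin cube W" for W
  proof -
    have "e ` {x \<in> M. e x \<notin> W} \<subseteq> topspace cube - W" using eval_in_cube by auto
    then have "cube closure_of (e ` {x \<in> M. e x \<notin> W}) \<subseteq> topspace cube - W"
      by (rule closure_of_minimal) (use that in blast)
    then show ?thesis unfolding trace_def by blast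
  qed
  show ?thesis
  proof (rule that[of "{x \<in> M. e x \<notin> U}" "{x \<in> M. e x \<notin> V}"])
    show "{x \<in> M. e x \<notin> U} \<union> {x \<in> M. e x \<notin> V} = M"
      using UV(5) by (auto simp: disjnt_iff)
  qed (use tr UV in blast)+
qed

text \<open>A separation of the trace by closed sets is induced by a covering of \<open>D\<close> by
  two parts with disjoint traces. These parts diverge, so one of them is bounded and contributes
  nothing to the trace.\<close>

lemma connectedin_traceI:
  assumes D: "D \<subseteq> M"
    and conn: "\<And>U V. U \<union> V = D \<Longrightarrow> coarsely_disjoint U V \<Longrightarrow> bdd U \<or> bdd V"
  shows "connectedin T (trace D)"
  unfolding connectedin_closedin
proof (intro conjI notI)
  assume "\<exists>E1 E2. closedin T E1 \<and> closedin T E2 \<and> trace D \<subseteq> E1 \<union> E2 \<and>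
    E1 \<inter> E2 \<inter> trace D = {} \<and> E1 \<inter> trace D \<noteq> {} \<and> E2 \<inter> trace D \<noteq> {}"
  then obtain E1 E2 where E: "closedin T E1" "closedin T E2" "trace D \<subseteq> E1 \<union> E2"
    "E1 \<inter> E2 \<inter> trace D = {}" "E1 \<inter> trace D \<noteq> {}" "E2 \<inter> trace D \<noteq> {}" by blast
  have "closedin T (E1 \<inter> trace D)" "closedin T (E2 \<inter> trace D)"
    "(E1 \<inter> trace D) \<inter> (E2 \<inter> trace D) = {}"
    using E closedin_trace by blast+
  from corona_separation[OF this] obtain A B where AB: "A \<subseteq> M" "B \<subseteq> M" "A \<union> B = M"
    "trace A \<inter> (E1 \<inter> trace D) = {}" "trace B \<inter> (E2 \<inter> trace D) = {}" .
  have sub: "trace (D \<inter> A) \<subseteq> trace A \<inter> trace D" "trace (D \<inter> B) \<subseteq> trace B \<inter> trace D"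
    by (simp_all add: trace_mono)
  have "trace (D \<inter> A) \<inter> trace (D \<inter> B) = {}" using sub AB E(3) by blast
  then have "coarsely_disjoint (D \<inter> A) (D \<inter> B)" using trace_disjoint_iff D by (metis inf.coboundedI1)
  moreover have DAB: "D \<inter> A \<union> D \<inter> B = D" using AB D by blast
  ultimately have "bdd (D \<inter> A) \<or> bdd (D \<inter> B)" by (rule conn[rotated])
  then have "trace (D \<inter> A) = {} \<or> trace (D \<inter> B) = {}"
    using trace_empty_iff D by (metis inf.coboundedI1)
  moreover have "trace D = trace (D \<inter> A) \<union> trace (D \<inter> B)" using trace_Un DAB by metis
  ultimately show False using sub AB E by blast
qed (rule trace_subset)

end

section \<open>Decomposable continua\<close>

lemma proper_subcontinuumI:
  assumes "compact_space T" "Hausdorff_space T" "closedin T A" "connectedin T A" "A \<noteq> {}" "A \<noteq> topspace T"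
  shows "proper_subcontinuum T A"
proof -
  have "A \<subset> topspace T" using assms closedin_subset by blast
  moreover have "compact_space (subtopology T A)"
    using closedin_compact_space[OF assms(1,3)] by (simp add: compact_space_subtopology)
  ultimately show ?thesis
    using assms unfolding proper_subcontinuum_def continuum_def connectedin_def
    by (simp add: Hausdorff_space_subtopology Int_absorb1)
qed

text \<open>In any separation the connected set \<open>P\<close> misses one of the two pieces. The
  trace of that piece on \<open>P \<union> M\<close> then lies in the open set \<open>M\<close> and
  is clopen in the whole space.\<close>

lemma connectedin_Un_complementary_part:
  assumes T: "connected_space T" and P: "connectedin T P" "P \<noteq> {}"
    and M: "openin T M" "P \<inter> M = {}" and PM: "closedin T (P \<union> M)"
  shows "connectedin T (P \<union> M)"
  unfolding connectedin_closedin
proof (intro conjI notI)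
  assume "\<exists>E1 E2. closedin T E1 \<and> closedin T E2 \<and> P \<union> M \<subseteq> E1 \<union> E2 \<and>
    E1 \<inter> E2 \<inter> (P \<union> M) = {} \<and> E1 \<inter> (P \<union> M) \<noteq> {} \<and> E2 \<inter> (P \<union> M) \<noteq> {}"
  then obtain E1 E2 where E: "closedin T E1" "closedin T E2" "P \<union> M \<subseteq> E1 \<union> E2"
    "E1 \<inter> E2 \<inter> (P \<union> M) = {}" "E1 \<inter> (P \<union> M) \<noteq> {}" "E2 \<inter> (P \<union> M) \<noteq> {}" by blast
  have *: False
    if "closedin T C1" "closedin T C2" "P \<union> M \<subseteq> C1 \<union> C2" "C1 \<inter> C2 \<inter> (P \<union> M) = {}"
      "C2 \<inter> (P \<union> M) \<noteq> {}" "C2 \<inter> P = {}" for C1 C2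
  proof -
    let ?S = "C2 \<inter> (P \<union> M)"
    have "closedin T ?S" using that(2) PM by blast
    moreover have "?S = M - C1" using that M(2) by blast
    then have "openin T ?S" using M(1) that(1) by (simp add: openin_diff)
    ultimately have "?S = topspace T" using T that(5) unfolding connected_space_clopen_in by blast
    moreover have "P \<subseteq> topspace T" using P(1) connectedin_subset_topspace by blast
    ultimately show False using that(6) P(2) by blast
  qed
  have "E1 \<inter> P = {} \<or> E2 \<inter> P = {}"
  proof (rule ccontr)
    assume "\<not> ?thesis"
    moreover have "P \<subseteq> E1 \<union> E2" "E1 \<inter> E2 \<inter> P = {}" using E by blast+
    ultimately show False using P(1) E(1,2) unfolding connectedin_closedin by blast
  qed
  then show False
  proof
    assume "E1 \<inter> P = {}"
    from *[OF E(2,1) _ _ E(5) this] E(3,4) show False by blast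
  next
    assume "E2 \<inter> P = {}"
    from *[OF E(1,2) _ _ E(6) this] E(3,4) show False by blast
  qed
qed (use PM closedin_subset in blast)

text \<open>The set \<open>H\<close> expresses that \<open>P\<close> has interior, namely the
  complement of \<open>H\<close>. If the complement \<open>W\<close> of \<open>P\<close> is
  connected, its closure stays in \<open>H\<close> and complements \<open>P\<close>; if
  \<open>W\<close> splits, adding either half to \<open>P\<close> gives a proper
  subcontinuum.\<close>

lemma decomposable_if_subcontinuum_with_interior:
  assumes T: "continuum T" and P: "closedin T P" "connectedin T P" "P \<noteq> topspace T"
    and H: "closedin T H" "H \<noteq> topspace T" "P \<union> H = topspace T"
  shows "decomposable T"
proof -
  have T': "compact_space T" "Hausdorff_space T" "connected_space T"
    using T unfolding continuum_def by auto
  define W where "W = topspace T - P"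
  have W: "openin T W" "W \<noteq> {}" "W \<subseteq> H"
    using P H closedin_subset[OF P(1)] by (auto simp: W_def)
  have Pne: "P \<noteq> {}" using H by blast
  have Psub: "P \<subseteq> topspace T" using closedin_subset[OF P(1)] .
  show ?thesis
  proof (cases "connectedin T W")
    case True
    let ?Q = "T closure_of W"
    have WQ: "W \<subseteq> ?Q" by (rule closure_of_subset) (simp add: W_def)
    have QH: "?Q \<subseteq> H" using closure_of_minimal[OF W(3) H(1)] .
    have QT: "?Q \<subseteq> topspace T" by (rule closure_of_subset_topspace)
    have "proper_subcontinuum T P" using T' P Pne by (intro proper_subcontinuumI)
    moreover have "proper_subcontinuum T ?Q"
      using T' connectedin_closure_of[OF True] WQ QH W(2) H(2) closedin_subset[OF H(1)]
      by (intro proper_subcontinuumI) auto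
    moreover have "P \<union> ?Q = topspace T" using WQ QT Psub by (auto simp: W_def)
    ultimately show ?thesis unfolding decomposable_def by blast
  next
    case False
    then obtain E1 E2 where E: "openin T E1" "openin T E2" "W \<subseteq> E1 \<union> E2" "E1 \<inter> E2 \<inter> W = {}"
      "E1 \<inter> W \<noteq> {}" "E2 \<inter> W \<noteq> {}"
      unfolding connectedin by (auto simp: W_def)
    have *: "proper_subcontinuum T (P \<union> (C1 \<inter> W))"
      if "openin T C1" "openin T C2" "W \<subseteq> C1 \<union> C2" "C1 \<inter> C2 \<inter> W = {}" "C2 \<inter> W \<noteq> {}" for C1 C2
    proof -
      have eq: "P \<union> (C1 \<inter> W) = topspace T - C2 \<inter> W"
        using that Psub by (auto simp: W_def)
      have op: "openin T (C1 \<inter> W)" "openin T (C2 \<inter> W)" using that W(1) by blast+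
      have cl: "closedin T (P \<union> (C1 \<inter> W))"
        unfolding eq using op(2) by blast
      have "connectedin T (P \<union> (C1 \<inter> W))"
        using T'(3) P(2) Pne op(1) cl
        by (intro connectedin_Un_complementary_part) (auto simp: W_def)
      moreover have "P \<union> (C1 \<inter> W) \<noteq> topspace T"
        unfolding eq using that(5) by (auto simp: W_def)
      ultimately show ?thesis using T' cl Pne by (intro proper_subcontinuumI) auto
    qed
    have "proper_subcontinuum T (P \<union> (E1 \<inter> W))" "proper_subcontinuum T (P \<union> (E2 \<inter> W))"
      using *[of E1 E2] *[of E2 E1] E by (auto simp: Un_commute Int_commute)
    moreover have "(P \<union> (E1 \<inter> W)) \<union> (P \<union> (E2 \<inter> W)) = topspace T"
      using E(3) Psub by (auto simp: W_def)
    ultimately show ?thesis unfolding decomposable_def by blast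
  qed
qed

section \<open>Spaces coarsely equivalent to the natural numbers\<close>

text \<open>Preimages of bounded sets need no separate hypothesis: if \<open>f x\<close> and
  \<open>f x'\<close> are within \<open>c\<close>, then \<open>x\<close> and \<open>x'\<close> are
  within \<open>2 * r + \<tau> c\<close>, by control of \<open>g\<close>. The inner fact
  \<open>cm\<close> is generic so that it serves both directions.\<close>

lemma coarse_equivalenceI:
  assumes f: "f \<in> mspace X \<rightarrow> mspace Y" and g: "g \<in> mspace Y \<rightarrow> mspace X"
    and \<sigma>: "\<And>t. 0 \<le> t \<Longrightarrow> 0 \<le> \<sigma> t" "\<And>s t. 0 \<le> s \<Longrightarrow> s \<le> t \<Longrightarrow> \<sigma> s \<le> \<sigma> t"
      "\<And>x x'. x \<in> mspace X \<Longrightarrow> x' \<in> mspace X \<Longrightarrow> mdist Y (f x) (f x') \<le> \<sigma> (mdist X x x')"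
    and \<tau>: "\<And>t. 0 \<le> t \<Longrightarrow> 0 \<le> \<tau> t" "\<And>s t. 0 \<le> s \<Longrightarrow> s \<le> t \<Longrightarrow> \<tau> s \<le> \<tau> t"
      "\<And>y y'. y \<in> mspace Y \<Longrightarrow> y' \<in> mspace Y \<Longrightarrow> mdist X (g y) (g y') \<le> \<tau> (mdist Y y y')"
    and gf: "\<And>x. x \<in> mspace X \<Longrightarrow> mdist X (g (f x)) x \<le> r"
    and fg: "\<And>y. y \<in> mspace Y \<Longrightarrow> mdist Y (f (g y)) y \<le> r"
  shows "coarse_equivalence X Y f"
proof -
  have cm: "coarse_map X Y f"
    if f: "f \<in> mspace X \<rightarrow> mspace Y" and g: "g \<in> mspace Y \<rightarrow> mspace X"
      and \<sigma>: "\<And>t. 0 \<le> t \<Longrightarrow> 0 \<le> \<sigma> t" "\<And>s t. 0 \<le> s \<Longrightarrow> s \<le> t \<Longrightarrow> \<sigma> s \<le> \<sigma> t"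
        "\<And>x x'. x \<in> mspace X \<Longrightarrow> x' \<in> mspace X \<Longrightarrow> mdist Y (f x) (f x') \<le> \<sigma> (mdist X x x')"
      and \<tau>: "\<And>t. 0 \<le> t \<Longrightarrow> 0 \<le> \<tau> t" "\<And>s t. 0 \<le> s \<Longrightarrow> s \<le> t \<Longrightarrow> \<tau> s \<le> \<tau> t"
        "\<And>y y'. y \<in> mspace Y \<Longrightarrow> y' \<in> mspace Y \<Longrightarrow> mdist X (g y) (g y') \<le> \<tau> (mdist Y y y')"
      and gf: "\<And>x. x \<in> mspace X \<Longrightarrow> mdist X (g (f x)) x \<le> r"
    for X :: "'c metric" and Y :: "'d metric" and f g \<sigma> \<tau>
    unfolding coarse_map_def
  proof (intro conjI allI impI exI[of _ \<sigma>])
    fix B assume B: "B \<subseteq> mspace Y" "mbounded_of Y B"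
    then obtain c where c: "\<forall>u \<in> B. \<forall>v \<in> B. mdist Y u v \<le> c"
      by (auto simp: Metric_space.mbounded_alt)
    have "mdist X x x' \<le> 2 * r + \<tau> c" if "x \<in> mspace X" "x' \<in> mspace X" "f x \<in> B" "f x' \<in> B" for x x'
    proof -
      have Y: "f x \<in> mspace Y" "f x' \<in> mspace Y" using f that by auto
      then have X: "g (f x) \<in> mspace X" "g (f x') \<in> mspace X" using g by auto
      have "mdist X (g (f x)) (g (f x')) \<le> \<tau> (mdist Y (f x) (f x'))" using \<tau>(3) Y by blast
      also have "\<dots> \<le> \<tau> c" using \<tau>(2) c that by simp
      finally show ?thesis
        using mdist_triangle[OF that(1) X(1) that(2)] mdist_triangle[OF X that(2)]
          gf[OF that(1)] gf[OF that(2)] mdist_commute[of X x "g (f x)"] by linarith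
    qed
    then show "mbounded_of X {x \<in> mspace X. f x \<in> B}"
      by (auto simp: Metric_space.mbounded_alt)
  qed (use f \<sigma> in \<open>auto simp: mono_on_def\<close>)
  have "coarse_map X Y f" by (rule cm[of f X Y g \<sigma> \<tau>]) (fact assms)+
  moreover have "coarse_map Y X g" by (rule cm[of g Y X f \<tau> \<sigma>]) (fact assms)+
  \<comment> \<open>Closeness asks for a positive strict bound, whence
    \<open>\<bar>r\<bar> + 1\<close>.\<close>
  moreover have "close_maps X X (g \<circ> f) id" "close_maps Y Y (f \<circ> g) id"
    using gf fg unfolding close_maps_def
    by (intro exI[of _ "\<bar>r\<bar> + 1"] conjI ballI; fastforce)+
  ultimately show ?thesis unfolding coarse_equivalence_def by blast
qed

text \<open>The controls are stated for any upper bound \<open>t\<close> of the distance, with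
  monotonicity built in, and one constant \<open>r\<close> serves both composites.\<close>

lemma coarse_equivalenceE:
  assumes "coarse_equivalence X Y f"
  obtains g \<sigma> \<tau> r where "f \<in> mspace X \<rightarrow> mspace Y" "g \<in> mspace Y \<rightarrow> mspace X"
    "\<And>t. 0 \<le> t \<Longrightarrow> 0 \<le> \<sigma> t" "\<And>s t. 0 \<le> s \<Longrightarrow> s \<le> t \<Longrightarrow> \<sigma> s \<le> \<sigma> t"
    "\<And>x x' t. x \<in> mspace X \<Longrightarrow> x' \<in> mspace X \<Longrightarrow> mdist X x x' \<le> t \<Longrightarrow> mdist Y (f x) (f x') \<le> \<sigma> t"
    "\<And>t. 0 \<le> t \<Longrightarrow> 0 \<le> \<tau> t" "\<And>s t. 0 \<le> s \<Longrightarrow> s \<le> t \<Longrightarrow> \<tau> s \<le> \<tau> t"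
    "\<And>y y' t. y \<in> mspace Y \<Longrightarrow> y' \<in> mspace Y \<Longrightarrow> mdist Y y y' \<le> t \<Longrightarrow> mdist X (g y) (g y') \<le> \<tau> t"
    "0 \<le> r" "\<And>x. x \<in> mspace X \<Longrightarrow> mdist X (g (f x)) x \<le> r"
    "\<And>y. y \<in> mspace Y \<Longrightarrow> mdist Y (f (g y)) y \<le> r"
proof -
  from assms obtain g where f: "coarse_map X Y f" and g: "coarse_map Y X g"
    and gf: "close_maps X X (g \<circ> f) id" and fg: "close_maps Y Y (f \<circ> g) id"
    unfolding coarse_equivalence_def by blast
  obtain \<sigma> where \<sigma>: "\<sigma> \<in> {0..} \<rightarrow> {0..}" "mono_on {0..} \<sigma>"
    "\<forall>x \<in> mspace X. \<forall>x' \<in> mspace X. mdist Y (f x) (f x') \<le> \<sigma> (mdist X x x')"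
    using f unfolding coarse_map_def by blast
  obtain \<tau> where \<tau>: "\<tau> \<in> {0..} \<rightarrow> {0..}" "mono_on {0..} \<tau>"
    "\<forall>y \<in> mspace Y. \<forall>y' \<in> mspace Y. mdist X (g y) (g y') \<le> \<tau> (mdist Y y y')"
    using g unfolding coarse_map_def by blast
  obtain r1 r2 where r: "r1 > 0" "\<forall>x \<in> mspace X. mdist X (g (f x)) x < r1"
    "r2 > 0" "\<forall>y \<in> mspace Y. mdist Y (f (g y)) y < r2"
    using gf fg unfolding close_maps_def by auto
  have "mdist Y (f x) (f x') \<le> \<sigma> t" if "x \<in> mspace X" "x' \<in> mspace X" "mdist X x x' \<le> t" for x x' t
    using \<sigma>(3) that mono_onD[OF \<sigma>(2), of "mdist X x x'" t] mdist_nonneg[of X x x']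
    by (metis atLeast_iff order_trans)
  moreover have "mdist X (g y) (g y') \<le> \<tau> t" if "y \<in> mspace Y" "y' \<in> mspace Y" "mdist Y y y' \<le> t" for y y' t
    using \<tau>(3) that mono_onD[OF \<tau>(2), of "mdist Y y y'" t] mdist_nonneg[of Y y y']
    by (metis atLeast_iff order_trans)
  ultimately show ?thesis
    using f g \<sigma>(1,2) \<tau>(1,2) r
    by (intro that[of g \<sigma> \<tau> "max r1 r2"]) (auto simp: coarse_map_def mono_on_def less_imp_le le_max_iff_disj)
qed

text \<open>A coarse equivalence with the natural numbers in unpacked form. They are taken as the
  type \<open>nat\<close> so that \<open>\<phi>\<close> can serve as an index.\<close>

locale coarse_ray_space = unbounded_proper_metric +
  fixes \<phi> :: "'a \<Rightarrow> nat" and \<gamma> :: "nat \<Rightarrow> 'a" and \<sigma> \<tau> :: "real \<Rightarrow> real" and r :: real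
  assumes \<gamma>_in: "\<gamma> n \<in> mspace X"
    and \<sigma>: "0 \<le> t \<Longrightarrow> 0 \<le> \<sigma> t" "0 \<le> s \<Longrightarrow> s \<le> t \<Longrightarrow> \<sigma> s \<le> \<sigma> t"
    and \<tau>: "0 \<le> t \<Longrightarrow> 0 \<le> \<tau> t" "0 \<le> s \<Longrightarrow> s \<le> t \<Longrightarrow> \<tau> s \<le> \<tau> t"
    and r: "0 \<le> r"
    and \<phi>_dist: "x \<in> mspace X \<Longrightarrow> y \<in> mspace X \<Longrightarrow> mdist X x y \<le> t \<Longrightarrow> \<bar>real (\<phi> x) - real (\<phi> y)\<bar> \<le> \<sigma> t"
    and \<gamma>_dist: "\<bar>real m - real n\<bar> \<le> t \<Longrightarrow> mdist X (\<gamma> m) (\<gamma> n) \<le> \<tau> t"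
    and \<gamma>_\<phi>: "x \<in> mspace X \<Longrightarrow> mdist X (\<gamma> (\<phi> x)) x \<le> r"
    and \<phi>_\<gamma>: "\<bar>real (\<phi> (\<gamma> n)) - real n\<bar> \<le> r"
begin

lemma dist_le_\<phi>:
  assumes "x \<in> M" "y \<in> M" "\<bar>real (\<phi> x) - real (\<phi> y)\<bar> \<le> t"
  shows "d x y \<le> \<tau> t + 2 * r"
  using mdist_triangle[OF assms(1) \<gamma>_in[of "\<phi> x"] assms(2)]
    mdist_triangle[OF \<gamma>_in[of "\<phi> x"] \<gamma>_in[of "\<phi> y"] assms(2)]
    \<gamma>_dist[OF assms(3)] \<gamma>_\<phi>[OF assms(1)] \<gamma>_\<phi>[OF assms(2)] mdist_commute[of X x "\<gamma> (\<phi> x)"]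
  by linarith

lemma bdd_iff_\<phi>:
  assumes "A \<subseteq> M"
  shows "bdd A \<longleftrightarrow> (\<exists>K. \<forall>x \<in> A. \<phi> x \<le> K)"
proof
  assume "bdd A"
  then obtain R where R: "\<forall>x \<in> A. d p0 x \<le> R" unfolding bdd_def by blast
  have "\<phi> x \<le> nat \<lceil>real (\<phi> p0) + \<sigma> R\<rceil>" if x: "x \<in> A" for x
    using \<phi>_dist[OF base, of x R] R assms x by (fastforce simp: le_nat_iff le_ceiling_iff)
  then show "\<exists>K. \<forall>x \<in> A. \<phi> x \<le> K" by blast
next
  assume "\<exists>K. \<forall>x \<in> A. \<phi> x \<le> K"
  then obtain K where K: "\<forall>x \<in> A. \<phi> x \<le> K" by blast
  have "d p0 x \<le> \<tau> (real (\<phi> p0) + real K) + 2 * r" if "x \<in> A" for x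
    by (rule dist_le_\<phi>) (use that K assms base in fastforce)+
  then show "bdd A" unfolding bdd_def by blast
qed

text \<open>Far out, consecutive points of \<open>\<gamma>\<close> cannot lie in different parts of
  a diverging cover. The part missing the tail of \<open>\<gamma>\<close> is bounded, because every
  point is within \<open>r\<close> of \<open>\<gamma>\<close>.\<close>

lemma connected_corona: "connectedin T (trace M)"
proof (rule connectedin_traceI)
  fix U V assume UV: "U \<union> V = M" "coarsely_disjoint U V"
  \<comment> \<open>The threshold covers a step along \<open>\<gamma>\<close> as well as the
    distance from a point to \<open>\<gamma>\<close>.\<close>
  let ?B = "{u \<in> U. \<exists>v \<in> V. d u v \<le> max (\<tau> 1) r}"
  have "bdd ?B" using UV(2) unfolding coarsely_disjoint_def by blast
  moreover have "?B \<subseteq> M" using UV by blast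
  ultimately obtain K where K: "\<And>x. x \<in> ?B \<Longrightarrow> \<phi> x \<le> K" using bdd_iff_\<phi> by meson
  \<comment> \<open>Since \<open>\<phi> (\<gamma> n)\<close> and \<open>n\<close> differ by at most
    \<open>r\<close>, points of \<open>\<gamma>\<close> with index beyond \<open>N\<close> have
    \<open>\<phi>\<close>-value above \<open>K\<close>.\<close>
  define N where "N = K + nat \<lceil>r\<rceil>"
  have near: "n \<le> N" if "\<phi> (\<gamma> n) \<le> K" for n
    using \<phi>_\<gamma>[of n] that r by (simp add: N_def) linarith
  have step: "\<gamma> n \<in> U \<longleftrightarrow> \<gamma> (Suc n) \<in> U" if "N < n" for n
  proof -
    have dist: "d (\<gamma> n) (\<gamma> (Suc n)) \<le> max (\<tau> 1) r" "d (\<gamma> (Suc n)) (\<gamma> n) \<le> max (\<tau> 1) r"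
      using \<gamma>_dist[of n "Suc n" 1] mdist_commute[of X "\<gamma> n"] by auto
    have "\<not> \<phi> (\<gamma> n) \<le> K" "\<not> \<phi> (\<gamma> (Suc n)) \<le> K" using near[of n] near[of "Suc n"] that by linarith+
    then have "\<gamma> n \<notin> ?B" "\<gamma> (Suc n) \<notin> ?B" using K by blast+
    then have "\<not> (\<gamma> n \<in> U \<and> \<gamma> (Suc n) \<in> V)" "\<not> (\<gamma> (Suc n) \<in> U \<and> \<gamma> n \<in> V)"
      using dist by blast+
    then show ?thesis using UV(1) \<gamma>_in by blast
  qed
  have const: "\<gamma> (Suc N + k) \<in> U \<longleftrightarrow> \<gamma> (Suc N) \<in> U" for k
  proof (induction k)
    case (Suc k)
    then show ?case using step[of "Suc N + k"] by simp
  qed simp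
  have tail: "\<gamma> n \<in> U \<longleftrightarrow> \<gamma> (Suc N) \<in> U" if "N < n" for n
    using const[of "n - Suc N"] that by simp
  show "bdd U \<or> bdd V"
  proof (cases "\<gamma> (Suc N) \<in> U")
    case True
    have "\<phi> v \<le> N" if v: "v \<in> V" for v
    proof (rule ccontr)
      assume "\<not> \<phi> v \<le> N"
      then have "\<gamma> (\<phi> v) \<in> ?B"
        using tail[of "\<phi> v"] True \<gamma>_\<phi>[of v] v UV(1) by (auto simp: le_max_iff_disj)
      then show False using K near \<open>\<not> \<phi> v \<le> N\<close> by blast
    qed
    then have "bdd V" using bdd_iff_\<phi>[of V] UV(1) by blast
    then show ?thesis ..
  next
    case False
    have "\<phi> u \<le> N" if u: "u \<in> U" for u
    proof (rule ccontr)
      assume *: "\<not> \<phi> u \<le> N"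
      then have "\<gamma> (\<phi> u) \<in> V" using tail[of "\<phi> u"] False UV(1) \<gamma>_in by auto
      moreover have "d u (\<gamma> (\<phi> u)) \<le> max (\<tau> 1) r"
        using \<gamma>_\<phi>[of u] u UV(1) mdist_commute[of X u] by (auto simp: le_max_iff_disj)
      ultimately have "\<phi> u \<le> K" using u K by blast
      then show False using * by (simp add: N_def)
    qed
    then have "bdd U" using bdd_iff_\<phi>[of U] UV(1) by blast
    then show ?thesis ..
  qed
qed simp

text \<open>The closed set \<open>Q\<close> witnesses the interior of \<open>P\<close>, as its
  nonempty open complement lies in \<open>P\<close>.\<close>

lemma no_connected_part_with_interior:
  assumes P: "closedin T P" "connectedin T P" "P \<noteq> topspace T"
    and Q: "closedin T Q" "Q \<noteq> topspace T" and PQ: "P \<union> Q = topspace T"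
  shows False
proof -
  obtain p q where pq: "p \<in> topspace T" "p \<notin> Q" "q \<in> topspace T" "q \<notin> P"
    using P Q PQ by blast
  have sing: "closedin T {p}" "closedin T {q}"
    using closedin_Hausdorff_singleton[OF Hausdorff_corona] pq by auto
  have cov: "A \<union> B = M \<Longrightarrow> trace A \<union> trace B = topspace T" for A B
    using trace_Un trace_space by metis
  \<comment> \<open>The three separations yield \<open>B0\<close> with trace covering
    \<open>P\<close>, an unbounded \<open>A1\<close> diverging from \<open>B0\<close>, and an
    unbounded \<open>A2\<close> with trace inside \<open>P\<close>.\<close>
  have "P \<inter> {q} = {}" using pq by blast
  from corona_separation[OF P(1) sing(2) this] obtain A0 B0 where
    0: "A0 \<subseteq> M" "B0 \<subseteq> M" "A0 \<union> B0 = M" "trace A0 \<inter> P = {}" "trace B0 \<inter> {q} = {}" .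
  from corona_separation[OF closedin_trace sing(2) 0(5)] obtain A1 B1 where
    1: "A1 \<subseteq> M" "B1 \<subseteq> M" "A1 \<union> B1 = M" "trace A1 \<inter> trace B0 = {}" "trace B1 \<inter> {q} = {}" .
  have "Q \<inter> {p} = {}" using pq by blast
  from corona_separation[OF Q(1) sing(1) this] obtain A2 B2 where
    2: "A2 \<subseteq> M" "B2 \<subseteq> M" "A2 \<union> B2 = M" "trace A2 \<inter> Q = {}" "trace B2 \<inter> {p} = {}" .
  have "q \<in> trace A1" using cov[OF 1(3)] 1(5) pq by blast
  then have unb1: "\<not> bdd A1" using trace_empty_iff[OF 1(1)] by blast
  have far: "coarsely_disjoint B0 A1" using 1(4) trace_disjoint_iff[OF 0(2) 1(1)] by blast
  have "p \<in> trace A2" using cov[OF 2(3)] 2(5) pq by blast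
  then have unb2: "\<not> bdd A2" using trace_empty_iff[OF 2(1)] by blast
  have tr2: "trace A2 \<subseteq> P" using trace_subset[of A2] 2(4) PQ by blast
  \<comment> \<open>Cutting down to \<open>B0\<close> loses only a bounded set: the trace of
    \<open>A2 \<inter> A0\<close> is both inside and disjoint from \<open>P\<close>.\<close>
  define V where "V = A2 \<inter> B0"
  have trV: "trace V \<subseteq> P" using trace_mono[of V A2] tr2 by (auto simp: V_def)
  have "trace (A2 \<inter> A0) = {}"
    using trace_mono[of "A2 \<inter> A0" A2] trace_mono[of "A2 \<inter> A0" A0] tr2 0(4) by blast
  then have "bdd (A2 \<inter> A0)" using trace_empty_iff[of "A2 \<inter> A0"] 0(1) by blast
  moreover have "A2 = (A2 \<inter> A0) \<union> V" using 0(3) 2(1) by (auto simp: V_def)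
  ultimately have unbV: "\<not> bdd V" using unb2 bdd_Un by metis
  have VM: "V \<subseteq> M" and VB0: "V \<subseteq> B0" using 0(2) by (auto simp: V_def)
  have "\<forall>k. \<exists>a. a \<in> A1 \<and> k < \<phi> a" using unb1 bdd_iff_\<phi>[OF 1(1)] by (meson not_le)
  then obtain a where a: "\<And>k. a k \<in> A1 \<and> k < \<phi> (a k)" by metis
  have "\<forall>k. \<exists>v. v \<in> V \<and> k < \<phi> v" using unbV bdd_iff_\<phi>[OF VM] by (meson not_le)
  then obtain v where v: "\<And>k. v k \<in> V \<and> k < \<phi> (v k)" by metis
  \<comment> \<open>From each \<open>s n\<close> in \<open>A1\<close> the recursion passes to a
    point of \<open>V\<close> further out and from there to the next point of \<open>A1\<close>, so
    the heights \<open>t n < \<phi> (w n) < t (Suc n)\<close> interleave.\<close>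
  define s where "s = rec_nat (a 0) (\<lambda>_ x. a (\<phi> (v (\<phi> x))))"
  have s: "s 0 = a 0" "s (Suc n) = a (\<phi> (v (\<phi> (s n))))" for n by (simp_all add: s_def)
  define t where "t n = \<phi> (s n)" for n
  define w where "w n = v (t n)" for n
  have sA1: "s n \<in> A1" for n by (cases n) (use s a in auto)
  have tw: "t n < \<phi> (w n)" "\<phi> (w n) < t (Suc n)" for n
    using v a by (auto simp: t_def w_def s)
  have wV: "w n \<in> V" for n using v by (simp add: w_def)
  have tmono: "strict_mono t" using tw by (intro strict_monoI_Suc) (meson less_trans)
  have tge: "n \<le> t n" for n using strict_mono_imp_increasing[OF tmono] .
  \<comment> \<open>The cuts that \<open>x\<close> has passed; their number is the index of the
    segment of \<open>x\<close>, and its parity colours \<open>B0\<close>.\<close>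
  define S where "S x = {n. t n \<le> \<phi> x}" for x
  have Sw: "S (w n) = {..n}" for n
  proof -
    have "t m \<le> \<phi> (w n) \<longleftrightarrow> m \<le> n" for m
    proof
      assume "t m \<le> \<phi> (w n)"
      then have "t m < t (Suc n)" using tw(2)[of n] by linarith
      then show "m \<le> n" using strict_mono_less[OF tmono] by simp
    next
      assume "m \<le> n"
      then have "t m \<le> t n" using strict_mono_less_eq[OF tmono] by simp
      then show "t m \<le> \<phi> (w n)" using tw(1)[of n] by linarith
    qed
    then show ?thesis by (auto simp: S_def)
  qed
  define E where "E b = {x \<in> B0. even (card (S x)) = b}" for b
  have EM: "E b \<subseteq> M" for b using 0(2) by (auto simp: E_def)
  have Ecov: "E True \<union> E False = B0" by (auto simp: E_def)
  have "coarsely_disjoint (E True) (E False)"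
    unfolding coarsely_disjoint_def
  proof
    fix \<rho>
    have "{x \<in> E True. \<exists>y \<in> E False. d x y \<le> \<rho>} \<subseteq> {x \<in> B0. \<exists>a \<in> A1. d x a \<le> \<tau> (\<sigma> \<rho>) + 2 * r}"
    proof clarify
      fix x y assume xy: "x \<in> E True" "y \<in> E False" "d x y \<le> \<rho>"
      then have "S x \<noteq> S y" by (auto simp: E_def)
      then obtain n where "t n \<le> \<phi> x \<longleftrightarrow> \<not> t n \<le> \<phi> y" by (auto simp: S_def)
      \<comment> \<open>A cut separates points of different colour, so \<open>\<phi> (s n)\<close>
        lies between their heights and \<open>x\<close> is close to a point of \<open>A1\<close>;
        since \<open>B0\<close> diverges from \<open>A1\<close>, such \<open>x\<close> are
        bounded.\<close>
      then have "\<bar>real (\<phi> x) - real (\<phi> (s n))\<bar> \<le> \<bar>real (\<phi> x) - real (\<phi> y)\<bar>"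
        unfolding t_def by linarith
      also have "\<dots> \<le> \<sigma> \<rho>" using \<phi>_dist[of x y \<rho>] xy EM by blast
      finally have "d x (s n) \<le> \<tau> (\<sigma> \<rho>) + 2 * r"
        using dist_le_\<phi>[of x "s n"] xy EM sA1 1(1) by blast
      then show "x \<in> B0 \<and> (\<exists>a \<in> A1. d x a \<le> \<tau> (\<sigma> \<rho>) + 2 * r)"
        using xy sA1 by (auto simp: E_def)
    qed
    then show "bdd {x \<in> E True. \<exists>y \<in> E False. d x y \<le> \<rho>}"
      using far bdd_subset unfolding coarsely_disjoint_def by blast
  qed
  then have disj: "trace (E True) \<inter> trace (E False) = {}"
    using trace_disjoint_iff EM by blast
  have meets: "trace (E b) \<inter> P \<noteq> {}" for b
  proof -
    \<comment> \<open>\<open>S (w n)\<close> is \<open>{..n}\<close> with \<open>n + 1\<close>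
      elements, so the even colour belongs to odd \<open>n\<close>.\<close>
    let ?W = "w ` {n. odd n = b}"
    have WE: "?W \<subseteq> E b" using wV VB0 by (auto simp: E_def Sw)
    have "\<not> (\<forall>x \<in> ?W. \<phi> x \<le> K)" for K
    proof -
      define n where "n = 2 * K + of_bool b"
      then have n: "K \<le> n" "odd n = b" by auto
      then have "K < \<phi> (w n)" using tge[of n] tw(1)[of n] by linarith
      then show ?thesis using n by fastforce
    qed
    moreover have WM: "?W \<subseteq> M" using WE EM by blast
    ultimately have "\<not> bdd ?W" using bdd_iff_\<phi> by blast
    then have "trace ?W \<noteq> {}" using trace_empty_iff[OF WM] by blast
    moreover have "trace ?W \<subseteq> trace (E b)" using trace_mono[OF WE] .
    moreover have "trace ?W \<subseteq> trace V" by (rule trace_mono) (use wV in blast)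
    ultimately show ?thesis using trV by blast
  qed
  have "P \<subseteq> trace B0" using cov[OF 0(3)] 0(4) PQ by blast
  then have "P \<subseteq> trace (E True) \<union> trace (E False)" using trace_Un Ecov by metis
  moreover have "trace (E True) \<inter> trace (E False) \<inter> P = {}" using disj by simp
  ultimately have "\<exists>E1 E2. closedin T E1 \<and> closedin T E2 \<and> P \<subseteq> E1 \<union> E2 \<and>
      E1 \<inter> E2 \<inter> P = {} \<and> E1 \<inter> P \<noteq> {} \<and> E2 \<inter> P \<noteq> {}"
    using closedin_trace meets by (intro exI[of _ "trace (E True)"] exI[of _ "trace (E False)"]) simp
  then show False using P(2) unfolding connectedin_closedin by simp
qed

lemma indecomposable_corona: "indecomposable_continuum T"
proof -
  have "topspace T \<noteq> {}" using trace_empty_iff[of M] trace_space not_bdd_space by auto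
  moreover have "connected_space T"
    using connected_corona by (simp add: trace_space connectedin_topspace)
  ultimately have "continuum T"
    unfolding continuum_def using compact_corona Hausdorff_corona by blast
  moreover have "\<not> decomposable T"
  proof
    assume "decomposable T"
    then obtain A B where AB: "proper_subcontinuum T A" "proper_subcontinuum T B" "A \<union> B = topspace T"
      unfolding decomposable_def by blast
    have cl: "closedin T C" if "proper_subcontinuum T C" for C
      using that unfolding proper_subcontinuum_def continuum_def
      by (auto intro!: compactin_imp_closedin[OF Hausdorff_corona] simp: compactin_subspace)
    have "connectedin T A" using AB(1) unfolding proper_subcontinuum_def continuum_def connectedin_def by blast
    then show False
      using no_connected_part_with_interior[of A B] AB cl unfolding proper_subcontinuum_def by blast
  qed
  ultimately show ?thesis unfolding indecomposable_continuum_def by blast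
qed

text \<open>The net is the range of \<open>\<gamma>\<close>. Two of its points in a ball of radius
  \<open>t\<close> have indices at most \<open>\<sigma> (2 * t) + 2 * r\<close> apart, so an
  interval of indices bounds their number.\<close>

lemma coarse_bounded_geometry: "coarse_bounded_geometry X"
proof -
  define m where "m t = nat \<lceil>\<sigma> (2 * t) + 2 * r\<rceil>" for t
  have net: "is_net X (range \<gamma>)"
    unfolding is_net_def
  proof (intro conjI exI[of _ "r + 1"] ballI)
    show "\<exists>a \<in> range \<gamma>. d x a < r + 1" if "x \<in> M" for x
      using \<gamma>_\<phi>[OF that] mdist_commute[of X x] by (intro bexI[of _ "\<gamma> (\<phi> x)"]) auto
  qed (use \<gamma>_in r in auto)
  have "finite (range \<gamma> \<inter> mcball_of X x t) \<and> card (range \<gamma> \<inter> mcball_of X x t) \<le> 2 * m t + 1"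
    if x: "x \<in> M" for x t
  proof (cases "range \<gamma> \<inter> mcball_of X x t = {}")
    case False
    then obtain n where n: "d x (\<gamma> n) \<le> t" by auto
    \<comment> \<open>Truncated subtraction only shortens the interval, so its cardinality bound
      survives.\<close>
    have "range \<gamma> \<inter> mcball_of X x t \<subseteq> \<gamma> ` {n - m t..n + m t}"
    proof clarify
      fix k assume "\<gamma> k \<in> mcball_of X x t"
      then have "d (\<gamma> k) (\<gamma> n) \<le> 2 * t"
        using mdist_triangle[OF \<gamma>_in x \<gamma>_in, of k n] n mdist_commute[of X x] by auto
      then have "\<bar>real (\<phi> (\<gamma> k)) - real (\<phi> (\<gamma> n))\<bar> \<le> \<sigma> (2 * t)" using \<phi>_dist \<gamma>_in by blast
      then have "\<bar>real k - real n\<bar> \<le> \<sigma> (2 * t) + 2 * r" using \<phi>_\<gamma>[of k] \<phi>_\<gamma>[of n] by linarith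
      also have "\<dots> \<le> real (m t)" unfolding m_def by linarith
      finally have "k \<in> {n - m t..n + m t}" by auto
      then show "\<gamma> k \<in> \<gamma> ` {n - m t..n + m t}" by blast
    qed
    then have "finite (range \<gamma> \<inter> mcball_of X x t)"
      "card (range \<gamma> \<inter> mcball_of X x t) \<le> card {n - m t..n + m t}"
      using finite_subset surj_card_le by blast+
    moreover have "card {n - m t..n + m t} \<le> 2 * m t + 1" by simp
    ultimately show ?thesis by linarith
  qed simp
  then have "finite (range \<gamma> \<inter> mcball_of X x t) \<and>
      real (card (range \<gamma> \<inter> mcball_of X x t)) \<le> real (2 * m t + 1)" if "x \<in> M" for x t
    using that by (metis of_nat_le_iff)
  with net show ?thesis
    unfolding coarse_bounded_geometry_def
    by (intro exI[of _ "range \<gamma>"] exI[of _ "\<lambda>t. real (2 * m t + 1)"]) auto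
qed

text \<open>The geodesic model is the half-line, reached from the natural numbers by rounding down.
  Rounding costs at most 1, whence \<open>\<tau> (t + 1)\<close> and \<open>r + 1\<close>.\<close>

lemma coarsely_geodesic: "coarsely_geodesic X"
proof (rule coarsely_geodesicI)
  let ?Y = "submetric (euclidean_metric :: real metric) {0..}"
  show "geodesic_metric ?Y"
    unfolding geodesic_metric_def
  proof (intro ballI)
    fix x y assume "x \<in> mspace ?Y" "y \<in> mspace ?Y"
    then have xy: "0 \<le> x" "0 \<le> y" by auto
    let ?c = "\<lambda>s. if x \<le> y then x + s else x - s"
    show "\<exists>c \<in> {0..mdist ?Y x y} \<rightarrow> mspace ?Y. c 0 = x \<and> c (mdist ?Y x y) = y \<and>
        (\<forall>s \<in> {0..mdist ?Y x y}. \<forall>t \<in> {0..mdist ?Y x y}. mdist ?Y (c s) (c t) = \<bar>s - t\<bar>)"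
      by (rule bexI[of _ ?c]) (use xy in \<open>auto simp: dist_real_def\<close>)
  qed
  have fl: "\<bar>real (nat \<lfloor>s\<rfloor>) - real (nat \<lfloor>t\<rfloor>)\<bar> \<le> \<bar>s - t\<bar> + 1" if "0 \<le> s" "0 \<le> t" for s t :: real
    using that by linarith
  have "coarse_equivalence X ?Y (\<lambda>x. real (\<phi> x))"
  proof (rule coarse_equivalenceI[where g = "\<lambda>t. \<gamma> (nat \<lfloor>t\<rfloor>)" and \<sigma> = \<sigma> and \<tau> = "\<lambda>t. \<tau> (t + 1)" and r = "r + 1"])
    show "mdist ?Y (real (\<phi> x)) (real (\<phi> x')) \<le> \<sigma> (d x x')" if "x \<in> M" "x' \<in> M" for x x'
      using \<phi>_dist[OF that order_refl] by (simp add: dist_real_def)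
    show "d (\<gamma> (nat \<lfloor>y\<rfloor>)) (\<gamma> (nat \<lfloor>y'\<rfloor>)) \<le> \<tau> (mdist ?Y y y' + 1)"
      if "y \<in> mspace ?Y" "y' \<in> mspace ?Y" for y y'
      by (rule \<gamma>_dist) (use fl that in \<open>auto simp: dist_real_def\<close>)
    show "d (\<gamma> (nat \<lfloor>real (\<phi> x)\<rfloor>)) x \<le> r + 1" if "x \<in> M" for x
      using \<gamma>_\<phi>[OF that] by simp
    show "mdist ?Y (real (\<phi> (\<gamma> (nat \<lfloor>y\<rfloor>)))) y \<le> r + 1" if "y \<in> mspace ?Y" for y
    proof -
      have "\<bar>real (nat \<lfloor>y\<rfloor>) - y\<bar> \<le> 1" using that by auto linarith
      then have "\<bar>real (\<phi> (\<gamma> (nat \<lfloor>y\<rfloor>))) - y\<bar> \<le> r + 1" using \<phi>_\<gamma>[of "nat \<lfloor>y\<rfloor>"] by linarith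
      then show ?thesis by (simp add: dist_real_def)
    qed
  qed (use \<gamma>_in \<sigma> \<tau> in auto)
  then show "coarsely_equivalent X ?Y" unfolding coarsely_equivalent_def by blast
qed

end

section \<open>Coarse rays in coarsely geodesic spaces\<close>

context unbounded_proper_metric
begin

lemma bdd_finite: "finite S \<Longrightarrow> bdd S"
  unfolding bdd_def by (intro exI[of _ "Max (d p0 ` S)"]) simp

lemma bdd_UN: "finite I \<Longrightarrow> (\<And>i. i \<in> I \<Longrightarrow> bdd (A i)) \<Longrightarrow> bdd (\<Union>i\<in>I. A i)"
  by (induction I rule: finite_induct) (auto simp: bdd_Un bdd_finite)

lemma coarsely_disjoint_commute: "A \<subseteq> M \<Longrightarrow> B \<subseteq> M \<Longrightarrow> coarsely_disjoint A B \<Longrightarrow> coarsely_disjoint B A"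
  using trace_disjoint_iff by (metis Int_commute)

text \<open>Each coordinate stays in a compact set, so successive subsequences converge coordinate
  by coordinate and the diagonal works for all of them.\<close>

lemma diagonal_limit:
  assumes u: "\<And>n i. u n i \<in> C i" and C: "\<And>i::nat. compactin (mtopology_of X) (C i)"
  obtains k z where "strict_mono (k :: nat \<Rightarrow> nat)" "\<And>i. z i \<in> M"
    "\<And>i \<epsilon>. \<epsilon> > 0 \<Longrightarrow> \<exists>N. \<forall>n\<ge>N. d (u (k n) i) (z i) < \<epsilon>"
proof -
  interpret Metric_space M d by simp
  let ?P = "\<lambda>i s. \<exists>l. limitin mtopology ((\<lambda>n. u n i) \<circ> s) l sequentially"
  interpret s: subseqs ?P
  proof
    fix i and s :: "nat \<Rightarrow> nat"
    have "compactin mtopology (C i)" using C by (simp add: mtopology_of_def)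
    moreover have "range ((\<lambda>n. u n i) \<circ> s) \<subseteq> C i" using u by auto
    ultimately have "\<exists>l r'. l \<in> C i \<and> strict_mono r' \<and>
        limitin mtopology (((\<lambda>n. u n i) \<circ> s) \<circ> r') l sequentially"
      unfolding compactin_sequentially by simp
    then obtain l r' where "strict_mono r'" "limitin mtopology ((\<lambda>n. u n i) \<circ> (s \<circ> r')) l sequentially"
      unfolding comp_assoc by (elim exE conjE)
    then show "\<exists>r'. strict_mono r' \<and> ?P i (s \<circ> r')" by (intro exI conjI)
  qed
  \<comment> \<open>Only the tail of the diagonal from \<open>Suc i\<close> on is a subsequence of
    the choice made for coordinate \<open>i\<close>.\<close>
  have "\<forall>i. ?P i (s.diagseq \<circ> (+) (Suc i))"
  proof
    fix i
    show "?P i (s.diagseq \<circ> (+) (Suc i))"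
    proof (rule s.diagseq_holds)
      fix r' s' :: "nat \<Rightarrow> nat" and n assume "strict_mono r'" "?P n s'"
      then show "?P n (s' \<circ> r')" using limitin_subsequence by (metis comp_assoc)
    qed
  qed
  from choice[OF this] obtain z where
    z: "\<And>i. limitin mtopology ((\<lambda>n. u n i) \<circ> (s.diagseq \<circ> (+) (Suc i))) (z i) sequentially"
    by auto
  show ?thesis
  proof (rule that[of s.diagseq z])
    show "strict_mono s.diagseq" by (rule s.subseq_diagseq)
    show "z i \<in> M" for i using z[of i] unfolding limit_metric_sequentially by blast
    show "\<exists>N. \<forall>n\<ge>N. d (u (s.diagseq n) i) (z i) < \<epsilon>" if "\<epsilon> > 0" for i \<epsilon>
    proof -
      have "\<exists>N. \<forall>n\<ge>N. d (u (s.diagseq (Suc i + n)) i) (z i) < \<epsilon>"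
        using z[of i] that unfolding limit_metric_sequentially comp_def by meson
      then obtain N where N: "\<forall>n\<ge>N. d (u (s.diagseq (Suc i + n)) i) (z i) < \<epsilon>" ..
      have "d (u (s.diagseq n) i) (z i) < \<epsilon>" if "n \<ge> Suc i + N" for n
        using N[rule_format, of "n - Suc i"] that by simp
      then show ?thesis by blast
    qed
  qed
qed

end

text \<open>Compactness is available in \<open>X\<close> only, so limits of geodesics of
  \<open>Y\<close> are taken after mapping them back by \<open>g\<close>.\<close>

locale coarsely_geodesic_space = unbounded_proper_metric X p0
  for X :: "'a metric" and p0 +
  fixes Y :: "'b metric" and f g and \<sigma> \<tau> :: "real \<Rightarrow> real" and r :: real
  assumes geodesic: "geodesic_metric Y"
    and f: "x \<in> mspace X \<Longrightarrow> f x \<in> mspace Y"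
    and g: "y \<in> mspace Y \<Longrightarrow> g y \<in> mspace X"
    and \<sigma>: "0 \<le> t \<Longrightarrow> 0 \<le> \<sigma> t" "0 \<le> s \<Longrightarrow> s \<le> t \<Longrightarrow> \<sigma> s \<le> \<sigma> t"
      "x \<in> mspace X \<Longrightarrow> x' \<in> mspace X \<Longrightarrow> mdist X x x' \<le> t \<Longrightarrow> mdist Y (f x) (f x') \<le> \<sigma> t"
    and \<tau>: "0 \<le> t \<Longrightarrow> 0 \<le> \<tau> t" "0 \<le> s \<Longrightarrow> s \<le> t \<Longrightarrow> \<tau> s \<le> \<tau> t"
      "y \<in> mspace Y \<Longrightarrow> y' \<in> mspace Y \<Longrightarrow> mdist Y y y' \<le> t \<Longrightarrow> mdist X (g y) (g y') \<le> \<tau> t"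
    and r: "0 \<le> r"
    and gf: "x \<in> mspace X \<Longrightarrow> mdist X (g (f x)) x \<le> r"
    and fg: "y \<in> mspace Y \<Longrightarrow> mdist Y (f (g y)) y \<le> r"
begin

text \<open>The geodesic is extended by its endpoint, so that it can be evaluated at every
  nonnegative time and stays 1-Lipschitz.\<close>

lemma geodesic_path:
  assumes "y \<in> mspace Y" "y' \<in> mspace Y"
  obtains c where "c 0 = y" "\<And>t. mdist Y y y' \<le> t \<Longrightarrow> c t = y'" "\<And>t. 0 \<le> t \<Longrightarrow> c t \<in> mspace Y"
    "\<And>s t. 0 \<le> s \<Longrightarrow> 0 \<le> t \<Longrightarrow> mdist Y (c s) (c t) \<le> \<bar>s - t\<bar>"
    "\<And>s t. s \<in> {0..mdist Y y y'} \<Longrightarrow> t \<in> {0..mdist Y y y'} \<Longrightarrow> mdist Y (c s) (c t) = \<bar>s - t\<bar>"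
proof -
  let ?l = "mdist Y y y'"
  obtain c where c: "c \<in> {0..?l} \<rightarrow> mspace Y" "c 0 = y" "c ?l = y'"
    "\<And>s t. s \<in> {0..?l} \<Longrightarrow> t \<in> {0..?l} \<Longrightarrow> mdist Y (c s) (c t) = \<bar>s - t\<bar>"
    using geodesic assms unfolding geodesic_metric_def by metis
  show ?thesis
  proof (rule that[of "\<lambda>t. c (min t ?l)"])
    show "c (min t ?l) \<in> mspace Y" if "0 \<le> t" for t using c(1) that by auto
    show "mdist Y (c (min s ?l)) (c (min t ?l)) \<le> \<bar>s - t\<bar>" if "0 \<le> s" "0 \<le> t" for s t
      using c(4)[of "min s ?l" "min t ?l"] that by auto
    show "mdist Y (c (min s ?l)) (c (min t ?l)) = \<bar>s - t\<bar>" if "s \<in> {0..?l}" "t \<in> {0..?l}" for s t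
      using c(4)[of s t] that by simp
  qed (use c in \<open>simp_all add: min_absorb2\<close>)
qed

text \<open>Sampled at integer times and mapped to \<open>X\<close>, the geodesics from
  \<open>f p0\<close> to the images of points tending to infinity have their \<open>i\<close>-th
  points in a fixed compact ball. A diagonal limit inherits both estimates; the added 1 absorbs an
  error of 1/2 at each end.\<close>

lemma coarse_ray:
  obtains z :: "nat \<Rightarrow> 'a" where "\<And>i. z i \<in> M"
    "\<And>i j. d (z i) (z j) \<le> \<tau> \<bar>real i - real j\<bar> + 1"
    "\<And>i j. \<bar>real i - real j\<bar> \<le> \<sigma> (d (z i) (z j) + 1) + 2 * r"
proof -
  obtain x where x: "\<And>n::nat. x n \<in> M" "\<And>n. real n + d p0 (g (f p0)) < d p0 (x n)"
  proof -
    have "\<forall>n::nat. \<exists>x. x \<in> M \<and> real n + d p0 (g (f p0)) < d p0 x" using unbounded by blast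
    then show ?thesis using that by metis
  qed
  define l where "l n = mdist Y (f p0) (f (x n))" for n
  have "\<exists>c. c 0 = f p0 \<and> (\<forall>t\<ge>0. c t \<in> mspace Y) \<and>
      (\<forall>s\<ge>0. \<forall>t\<ge>0. mdist Y (c s) (c t) \<le> \<bar>s - t\<bar>) \<and>
      (\<forall>s \<in> {0..l n}. \<forall>t \<in> {0..l n}. mdist Y (c s) (c t) = \<bar>s - t\<bar>)" for n
    unfolding l_def by (rule geodesic_path[OF f[OF base] f[OF x(1)]]) blast
  then obtain c where c: "\<And>n. c n 0 = f p0" "\<And>n t. 0 \<le> t \<Longrightarrow> c n t \<in> mspace Y"
    "\<And>n s t. 0 \<le> s \<Longrightarrow> 0 \<le> t \<Longrightarrow> mdist Y (c n s) (c n t) \<le> \<bar>s - t\<bar>"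
    "\<And>n s t. s \<in> {0..l n} \<Longrightarrow> t \<in> {0..l n} \<Longrightarrow> mdist Y (c n s) (c n t) = \<bar>s - t\<bar>"
    by metis
  define u where "u n i = g (c n (real i))" for n i
  have uM: "u n i \<in> M" for n i unfolding u_def using c(2) g by simp
  have ud: "d (u n i) (u n j) \<le> \<tau> \<bar>real i - real j\<bar>" for n i j
    unfolding u_def using c(2,3) \<tau>(3) by simp
  have u0: "u n 0 = g (f p0)" for n by (simp add: u_def c)
  \<comment> \<open>A geodesic shorter than \<open>i\<close> would put \<open>g (f (x n))\<close>
    within \<open>\<tau> (real i)\<close> of \<open>g (f p0)\<close>, too close for the chosen
    \<open>x n\<close>.\<close>
  have lg: "real i \<le> l n" if "r + \<tau> (real i) \<le> real n" for i n
  proof (rule ccontr)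
    assume "\<not> real i \<le> l n"
    then have "d (g (f p0)) (g (f (x n))) \<le> \<tau> (real i)"
      unfolding l_def using \<tau>(3)[OF f[OF base] f[OF x(1)[of n]]] by simp
    then show False
      using x(2)[of n] that gf[OF x(1)[of n]] g[OF f[OF base]] g[OF f[OF x(1)[of n]]]
        mdist_triangle[OF base g[OF f[OF base]] x(1)[of n]]
        mdist_triangle[OF g[OF f[OF base]] g[OF f[OF x(1)[of n]]] x(1)[of n]] by linarith
  qed
  obtain k z where k: "strict_mono (k :: nat \<Rightarrow> nat)" and z: "\<And>i. z i \<in> M"
    "\<And>i \<epsilon>. \<epsilon> > 0 \<Longrightarrow> \<exists>N. \<forall>n\<ge>N. d (u (k n) i) (z i) < \<epsilon>"
  proof (rule diagonal_limit[where u = u and C = "\<lambda>i. mcball_of X (g (f p0)) (\<tau> (real i))"])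
    show "u n i \<in> mcball_of X (g (f p0)) (\<tau> (real i))" for n i
      using ud[of n 0 i] uM g[OF f[OF base]] by (simp add: u0)
    show "compactin (mtopology_of X) (mcball_of X (g (f p0)) (\<tau> (real i)))" for i
      using proper g[OF f[OF base]] unfolding proper_metric_def by blast
  qed (rule that)
  have approx: "\<exists>n. d (u n i) (z i) \<le> 1/2 \<and> d (u n j) (z j) \<le> 1/2 \<and> real i \<le> l n \<and> real j \<le> l n" for i j
  proof -
    obtain N where N: "\<forall>n\<ge>N. d (u (k n) i) (z i) < 1/2" using z(2)[of "1/2" i] by auto
    obtain N' where N': "\<forall>n\<ge>N'. d (u (k n) j) (z j) < 1/2" using z(2)[of "1/2" j] by auto
    obtain q :: nat where q: "max (r + \<tau> (real i)) (r + \<tau> (real j)) \<le> real q"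
      using real_arch_simple by blast
    define n where "n = max q (max N N')"
    have "n \<le> k n" using strict_mono_imp_increasing[OF k] .
    then have "real q \<le> real (k n)" by (simp add: n_def)
    then have "real i \<le> l (k n)" "real j \<le> l (k n)" using q by (auto intro!: lg)
    moreover have "d (u (k n) i) (z i) < 1/2" "d (u (k n) j) (z j) < 1/2"
      using N N' by (auto simp: n_def)
    ultimately show ?thesis by (intro exI[of _ "k n"]) auto
  qed
  show ?thesis
  proof (rule that[of z])
    fix i j
    obtain n where n: "d (u n i) (z i) \<le> 1/2" "d (u n j) (z j) \<le> 1/2" "real i \<le> l n" "real j \<le> l n"
      using approx by blast
    have *: "\<bar>d (z i) (z j) - d (u n i) (u n j)\<bar> \<le> 1"
      using mdist_triangle[OF z(1)[of i] uM[of n i] z(1)[of j]] mdist_triangle[OF uM[of n i] uM[of n j] z(1)[of j]]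
        mdist_triangle[OF uM[of n i] z(1)[of i] uM[of n j]] mdist_triangle[OF z(1)[of i] z(1)[of j] uM[of n j]]
        n(1,2) mdist_commute[of X "z i" "u n i"] mdist_commute[of X "z j" "u n j"] by linarith
    show "d (z i) (z j) \<le> \<tau> \<bar>real i - real j\<bar> + 1" using * ud[of n i j] by linarith
    have cY: "c n (real i) \<in> mspace Y" "c n (real j) \<in> mspace Y" using c(2) by auto
    have fuY: "f (u n i) \<in> mspace Y" "f (u n j) \<in> mspace Y" using f uM by auto
    have "mdist Y (f (u n i)) (f (u n j)) \<le> \<sigma> (d (z i) (z j) + 1)"
      by (rule \<sigma>(3)[OF uM uM]) (use * in linarith)
    moreover have "mdist Y (f (u n i)) (c n (real i)) \<le> r" "mdist Y (f (u n j)) (c n (real j)) \<le> r"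
      unfolding u_def using fg cY by auto
    moreover have "mdist Y (c n (real i)) (c n (real j)) = \<bar>real i - real j\<bar>"
      using c(4) n by simp
    ultimately show "\<bar>real i - real j\<bar> \<le> \<sigma> (d (z i) (z j) + 1) + 2 * r"
      using mdist_triangle[OF cY(1) fuY(1) cY(2)] mdist_triangle[OF fuY cY(2)]
        mdist_commute[of Y "c n (real i)" "f (u n i)"] by linarith
  qed (rule z)
qed

section \<open>Coarsely dense and non-dense rays\<close>

context
  fixes z :: "nat \<Rightarrow> 'a"
  assumes z: "\<And>i. z i \<in> M"
    and z_le: "\<And>i j. d (z i) (z j) \<le> \<tau> \<bar>real i - real j\<bar> + 1"
    and z_ge: "\<And>i j. \<bar>real i - real j\<bar> \<le> \<sigma> (d (z i) (z j) + 1) + 2 * r"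
begin

text \<open>Choosing for each point the index of a ray point within \<open>s\<close> inverts the ray
  up to bounded error; \<open>z_ge\<close> controls this index map and \<open>z_le\<close> the
  ray.\<close>

lemma coarsely_equivalent_nat_if_dense:
  assumes s: "\<And>x. x \<in> M \<Longrightarrow> \<exists>i. d x (z i) \<le> s"
  shows "coarsely_equivalent X (submetric (euclidean_metric :: real metric) \<nat>)"
proof -
  let ?N = "submetric (euclidean_metric :: real metric) \<nat>"
  obtain \<phi> where \<phi>: "\<And>x. x \<in> M \<Longrightarrow> d x (z (\<phi> x)) \<le> s" using s by metis
  have s0: "0 \<le> s" using \<phi>[OF base] mdist_nonneg[of X p0] by (meson order_trans)
  have "coarse_equivalence X ?N (\<lambda>x. real (\<phi> x))"
  proof (rule coarse_equivalenceI[where g = "\<lambda>t. z (nat \<lfloor>t\<rfloor>)" and \<sigma> = "\<lambda>t. \<sigma> (t + 2 * s + 1) + 2 * r"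
        and \<tau> = "\<lambda>t. \<tau> t + 1" and r = "max s (\<sigma> (s + 1) + 2 * r)"])
    fix x x' assume x: "x \<in> M" "x' \<in> M"
    have "d (z (\<phi> x)) (z (\<phi> x')) \<le> d x x' + 2 * s"
      using mdist_triangle[OF z[of "\<phi> x"] x(1) z[of "\<phi> x'"]] mdist_triangle[OF x z[of "\<phi> x'"]]
        \<phi>[OF x(1)] \<phi>[OF x(2)] mdist_commute[of X x "z (\<phi> x)"] by linarith
    then have "\<sigma> (d (z (\<phi> x)) (z (\<phi> x')) + 1) \<le> \<sigma> (d x x' + 2 * s + 1)" by (intro \<sigma>(2)) auto
    then show "mdist ?N (real (\<phi> x)) (real (\<phi> x')) \<le> \<sigma> (d x x' + 2 * s + 1) + 2 * r"
      using z_ge[of "\<phi> x" "\<phi> x'"] by (simp add: dist_real_def)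
  next
    fix y assume "y \<in> mspace ?N"
    then obtain i where i: "y = real i" by (auto elim: Nats_cases)
    have "\<sigma> (d (z (\<phi> (z i))) (z i) + 1) \<le> \<sigma> (s + 1)"
      using \<phi>[OF z, of i] mdist_commute[of X "z i"] by (intro \<sigma>(2)) auto
    then show "mdist ?N (real (\<phi> (z (nat \<lfloor>y\<rfloor>)))) y \<le> max s (\<sigma> (s + 1) + 2 * r)"
      using z_ge[of "\<phi> (z i)" i] by (simp add: i dist_real_def)
  next
    fix y y' assume "y \<in> mspace ?N" "y' \<in> mspace ?N"
    then show "d (z (nat \<lfloor>y\<rfloor>)) (z (nat \<lfloor>y'\<rfloor>)) \<le> \<tau> (mdist ?N y y') + 1"
      using z_le by (auto elim!: Nats_cases simp: dist_real_def)
  next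
    show "d (z (nat \<lfloor>real (\<phi> x)\<rfloor>)) x \<le> max s (\<sigma> (s + 1) + 2 * r)" if "x \<in> M" for x
      using \<phi>[OF that] mdist_commute[of X x] by (simp add: le_max_iff_disj)
  qed (use z \<sigma> \<tau> s0 r in auto)
  then show ?thesis unfolding coarsely_equivalent_def by blast
qed

lemma ray_far:
  assumes "x \<in> M"
  obtains I where "\<And>i. I \<le> i \<Longrightarrow> R < d x (z i)"
proof -
  have "R < d x (z i)" if "Suc (nat \<lceil>\<sigma> (max R 0 + d x (z 0) + 1) + 2 * r\<rceil>) \<le> i" for i
  proof (rule ccontr)
    assume "\<not> R < d x (z i)"
    then have "d (z i) (z 0) + 1 \<le> max R 0 + d x (z 0) + 1"
      using mdist_triangle[OF z assms z, of i 0] mdist_commute[of X x] by auto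
    then have "\<sigma> (d (z i) (z 0) + 1) \<le> \<sigma> (max R 0 + d x (z 0) + 1)" by (intro \<sigma>(2)) auto
    then show False using z_ge[of i 0] that by simp linarith
  qed
  then show ?thesis using that by blast
qed

text \<open>If the ray is not coarsely dense, there are points \<open>w j\<close> escaping from it. Attaching to the ray
  larger and larger balls, centred so far out that the \<open>w j\<close> still escape from them, gives a set \<open>D\<close>
  whose trace is a proper subcontinuum with nonempty interior.\<close>

lemma decomposable_if_not_dense:
  assumes not_dense: "\<And>s. \<exists>x \<in> M. \<forall>i. s < d x (z i)" and cont: "continuum T"
  shows "decomposable T"
proof -
  \<comment> \<open>The radius in \<open>X\<close> that accommodates the image of a ball of radius
    \<open>k\<close> in \<open>Y\<close>, with \<open>r\<close> spent on passing from the centre to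
    its image under \<open>g \<circ> f\<close>.\<close>
  define \<rho> where "\<rho> k = \<tau> (real k) + r" for k
  have \<rho>0: "0 \<le> \<rho> k" and \<rho>mono: "k \<le> j \<Longrightarrow> \<rho> k \<le> \<rho> j" for k j
    using \<tau> r by (auto simp: \<rho>_def)
  have "\<forall>j. \<exists>x. x \<in> M \<and> (\<forall>i. \<rho> j + real j < d x (z i))" using not_dense by blast
  then obtain w where w: "\<And>j. w j \<in> M" "\<And>j i. \<rho> j + real j < d (w j) (z i)" by metis
  \<comment> \<open>The centre of the \<open>k\<close>-th ball has to avoid only \<open>w 0\<close>
    to \<open>w k\<close>: for \<open>j > k\<close>, the distance of \<open>w j\<close> from the ray
    already exceeds \<open>\<rho> k + real j\<close>.\<close>
  have "\<exists>n\<ge>k. \<forall>x \<in> insert p0 (w ` {..k}). \<rho> k + real k < d x (z n)" for k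
  proof -
    have "\<forall>x. \<exists>I. x \<in> M \<longrightarrow> (\<forall>i\<ge>I. \<rho> k + real k < d x (z i))" by (meson ray_far)
    then obtain I where I: "\<And>x i. x \<in> M \<Longrightarrow> I x \<le> i \<Longrightarrow> \<rho> k + real k < d x (z i)" by metis
    let ?F = "insert p0 (w ` {..k})"
    define n where "n = Max (insert k (I ` ?F))"
    have "I x \<le> n" if "x \<in> ?F" for x using that unfolding n_def by (intro Max_ge) auto
    moreover have "k \<le> n" unfolding n_def by (intro Max_ge) auto
    ultimately show ?thesis using I base w(1) by (intro exI[of _ n]) auto
  qed
  then obtain n where n: "\<And>k. k \<le> n k" "\<And>k. \<rho> k + real k < d p0 (z (n k))"
    "\<And>k j. j \<le> k \<Longrightarrow> \<rho> k + real k < d (w j) (z (n k))" by (metis atMost_iff imageI insertI1 insertI2)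
  \<comment> \<open>Balls are taken in \<open>Y\<close> and mapped to \<open>X\<close>, since there
    each point is joined to the centre by a geodesic inside the ball.\<close>
  define E where "E k = g ` {y \<in> mspace Y. mdist Y (f (z (n k))) y \<le> real k}" for k
  define D where "D = range z \<union> (\<Union>k. E k)"
  have EM: "E k \<subseteq> M" for k using g by (auto simp: E_def)
  have DM: "D \<subseteq> M" using EM z by (auto simp: D_def)
  have E_near: "d (z (n k)) x \<le> \<rho> k" if x: "x \<in> E k" for k x
  proof -
    obtain y where y: "y \<in> mspace Y" "mdist Y (f (z (n k))) y \<le> real k" "x = g y"
      using x by (auto simp: E_def)
    have fz: "f (z (n k)) \<in> mspace Y" using f z by blast
    show ?thesis
      using mdist_triangle[OF z[of "n k"] g[OF fz] g[OF y(1)]] \<tau>(3)[OF fz y(1,2)] gf[OF z, of "n k"]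
        mdist_commute[of X "z (n k)" "g (f (z (n k)))"] unfolding \<rho>_def y(3) by (smt (verit))
  qed
  have E_far: "real k < d p0 x" if "x \<in> E k" for k x
    using E_near[OF that] n(2)[of k] mdist_triangle[OF base, of x "z (n k)"] z EM that
      mdist_commute[of X x] by fastforce
  have bddE: "bdd (E k)" for k
    unfolding bdd_def
  proof (intro exI ballI)
    show "d p0 x \<le> d p0 (z (n k)) + \<rho> k" if "x \<in> E k" for x
      using E_near[OF that] mdist_triangle[OF base z, of x "n k"] EM that by fastforce
  qed
  have w_far: "real j < d (w j) a" if a: "a \<in> D" for j a
  proof (cases "a \<in> range z")
    case True
    then obtain i where "a = z i" by blast
    then show ?thesis using w(2)[of j i] \<rho>0[of j] by simp
  next
    case False
    then obtain k where k: "a \<in> E k" using a by (auto simp: D_def)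
    have *: "d (w j) (z (n k)) \<le> d (w j) a + \<rho> k"
      using E_near[OF k] mdist_triangle[OF w(1) _ z, of a j "n k"] EM k mdist_commute[of X a] by fastforce
    show ?thesis
    proof (cases "j \<le> k")
      case True
      then show ?thesis using * n(3)[OF True] by linarith
    next
      case False
      then show ?thesis using * w(2)[of j "n k"] \<rho>mono[of k j] by linarith
    qed
  qed
  have "connectedin T (trace D)"
  proof (rule connectedin_traceI[OF DM])
    fix U V assume UV: "U \<union> V = D" "coarsely_disjoint U V"
    \<comment> \<open>Large enough for a step along the ray, a unit step inside some
      \<open>E k\<close>, and the jump from a centre to its image under
      \<open>g \<circ> f\<close>.\<close>
    define s where "s = max (\<tau> 1) r + 1 + \<tau> 1"
    have s: "\<tau> 1 \<le> s" "\<tau> 1 + 1 \<le> s" "r \<le> s" "0 \<le> s"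
      using \<tau>(1)[of 1] r by (auto simp: s_def)
    have one: "bdd V"
      if UV: "U \<union> V = D" "coarsely_disjoint U V" "coarsely_disjoint V U" and tail: "\<And>i. I \<le> i \<Longrightarrow> z i \<in> U" for U V I
    proof -
      have "bdd {u \<in> U. \<exists>v \<in> V. d u v \<le> s}" "bdd {v \<in> V. \<exists>u \<in> U. d v u \<le> s}"
        using UV unfolding coarsely_disjoint_def by blast+
      then obtain R1 R2 where "\<forall>u \<in> {u \<in> U. \<exists>v \<in> V. d u v \<le> s}. d p0 u \<le> R1"
        "\<forall>v \<in> {v \<in> V. \<exists>u \<in> U. d v u \<le> s}. d p0 v \<le> R2"
        unfolding bdd_def by blast
      then have R: "d p0 u \<le> max R1 R2" "d p0 v \<le> max R1 R2" if "u \<in> U" "v \<in> V" "d u v \<le> s" for u v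
        using that mdist_commute[of X u v] by (fastforce simp: le_max_iff_disj)+
      \<comment> \<open>From index \<open>K\<close> on, \<open>E k\<close> lies beyond both radii,
        and its centre is on the tail because \<open>k \<le> n k\<close>.\<close>
      define K where "K = max I (nat \<lceil>max R1 R2\<rceil>)"
      have sep: "v \<notin> V" if "u \<in> U" "u \<in> E k" "K \<le> k" "d u v \<le> s" for u v k
        using R[of u v] E_far[of u k] that by (force simp: K_def)
      \<comment> \<open>Start at the centre, which is in \<open>U\<close>, and follow the geodesic
        in unit steps: each is too short to cross to \<open>V\<close> this far out. At time
        \<open>k\<close> the extended path has reached \<open>y\<close>.\<close>
      have off: "v \<notin> V" if v: "v \<in> E k" and k: "K \<le> k" for v k
      proof -
        obtain y where y: "y \<in> mspace Y" "mdist Y (f (z (n k))) y \<le> real k" "v = g y"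
          using v by (auto simp: E_def)
        have fz: "f (z (n k)) \<in> mspace Y" using f z by blast
        obtain c where c: "c 0 = f (z (n k))" "\<And>t. mdist Y (f (z (n k))) y \<le> t \<Longrightarrow> c t = y"
          "\<And>t. 0 \<le> t \<Longrightarrow> c t \<in> mspace Y"
          "\<And>s t. 0 \<le> s \<Longrightarrow> 0 \<le> t \<Longrightarrow> mdist Y (c s) (c t) \<le> \<bar>s - t\<bar>"
          using geodesic_path[OF fz y(1)] by metis
        have cE: "g (c (real i)) \<in> E k" if "i \<le> k" for i
          using c(4)[of 0 "real i"] c(1,3) that by (auto simp: E_def)
        have "g (c (real i)) \<in> U" if "i \<le> k" for i
          using that
        proof (induction i)
          case 0
          have "z (n k) \<in> U" using tail n(1)[of k] k by (simp add: K_def)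
          moreover have "d (z (n k)) (g (c 0)) \<le> s"
            using gf[OF z, of "n k"] s(3) mdist_commute[of X "z (n k)"] c(1) by simp
          moreover have "\<not> d p0 (g (c 0)) \<le> max R1 R2"
            using E_far[OF cE[of 0]] k by (simp add: K_def) linarith
          ultimately have "g (c 0) \<notin> V" using R(2) by blast
          then show ?case using UV(1) cE[of 0] by (auto simp: D_def)
        next
          case (Suc i)
          have "mdist Y (c (real i)) (c (real (Suc i))) \<le> 1" using c(4)[of "real i" "real (Suc i)"] by simp
          then have "d (g (c (real i))) (g (c (real (Suc i)))) \<le> s"
            using \<tau>(3)[of "c (real i)" "c (real (Suc i))" 1] c(3) s(1) by fastforce
          then have "g (c (real (Suc i))) \<notin> V" using sep[OF _ cE k] Suc by simp
          then show ?case using UV(1) cE[OF Suc.prems] by (auto simp: D_def)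
        qed
        then have "v \<in> U" using c(2)[OF y(2)] y(3) by fastforce
        moreover have "d v v \<le> s" using v EM[of k] s(4) by auto
        ultimately show "v \<notin> V" using sep[OF _ v k] by blast
      qed
      \<comment> \<open>The parts may overlap; a point in both is caught by the middle set, being at
        distance 0 from itself.\<close>
      have "V \<subseteq> z ` {..<I} \<union> {u \<in> U. \<exists>v \<in> V. d u v \<le> s} \<union> (\<Union>k\<in>{..<K}. E k)"
      proof
        fix v assume v: "v \<in> V"
        then have "v \<in> D" using UV(1) by blast
        then consider i where "v = z i" | k where "v \<in> E k" unfolding D_def by blast
        then show "v \<in> z ` {..<I} \<union> {u \<in> U. \<exists>v \<in> V. d u v \<le> s} \<union> (\<Union>k\<in>{..<K}. E k)"
        proof cases
          case 1
          show ?thesis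
          proof (cases "i < I")
            case False
            then have "v \<in> U" "d v v \<le> s" using tail 1 z s(4) by auto
            then show ?thesis using v by blast
          qed (use 1 in blast)
        next
          case 2
          then show ?thesis using off v by (meson UN_I UnI2 lessThan_iff not_less)
        qed
      qed
      moreover have "bdd (z ` {..<I} \<union> {u \<in> U. \<exists>v \<in> V. d u v \<le> s} \<union> (\<Union>k\<in>{..<K}. E k))"
        using UV(2) bddE unfolding bdd_Un coarsely_disjoint_def by (simp add: bdd_finite bdd_UN)
      ultimately show "bdd V" using bdd_subset by blast
    qed
    have VU: "coarsely_disjoint V U" by (rule coarsely_disjoint_commute[OF _ _ UV(2)]) (use UV DM in blast)+
    have "bdd {u \<in> U. \<exists>v \<in> V. d u v \<le> s}" using UV unfolding coarsely_disjoint_def by blast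
    then obtain R where R: "\<And>u v. u \<in> U \<Longrightarrow> v \<in> V \<Longrightarrow> d u v \<le> s \<Longrightarrow> d p0 u \<le> R"
      unfolding bdd_def by blast
    obtain I where I: "\<And>i. I \<le> i \<Longrightarrow> R < d p0 (z i)" using ray_far[OF base] by blast
    have step: "z i \<in> U \<longleftrightarrow> z (Suc i) \<in> U" if "I \<le> i" for i
    proof -
      have dist: "d (z i) (z (Suc i)) \<le> s" "d (z (Suc i)) (z i) \<le> s"
        using z_le[of i "Suc i"] s(2) mdist_commute[of X "z i"] by auto
      have "\<not> d p0 (z i) \<le> R" "\<not> d p0 (z (Suc i)) \<le> R" using I[of i] I[of "Suc i"] that by auto
      then have "\<not> (z i \<in> U \<and> z (Suc i) \<in> V)" "\<not> (z (Suc i) \<in> U \<and> z i \<in> V)" using R dist by blast+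
      moreover have "z i \<in> U \<union> V" "z (Suc i) \<in> U \<union> V" using UV(1) by (auto simp: D_def)
      ultimately show ?thesis by blast
    qed
    have const: "z (I + i) \<in> U \<longleftrightarrow> z I \<in> U" for i
    proof (induction i)
      case (Suc i)
      then show ?case using step[of "I + i"] by simp
    qed simp
    show "bdd U \<or> bdd V"
    proof (cases "z I \<in> U")
      case True
      then have "z i \<in> U" if "I \<le> i" for i using const[of "i - I"] that by simp
      then show ?thesis using one[OF UV VU] by blast
    next
      case False
      have "z i \<in> V" if "I \<le> i" for i
      proof -
        have "z i \<notin> U" using const[of "i - I"] that False by simp
        moreover have "z i \<in> U \<union> V" using UV(1) by (auto simp: D_def)
        ultimately show ?thesis by blast
      qed
      then show ?thesis using one[of V U I] UV VU by (simp add: Un_commute)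
    qed
  qed
  \<comment> \<open>The escaping points \<open>w j\<close> form an unbounded set diverging from
    \<open>D\<close>, so their trace is nonempty and missed by \<open>trace D\<close>.\<close>
  moreover have "trace D \<noteq> topspace T"
  proof -
    have WM: "range w \<subseteq> M" using w by blast
    have "coarsely_disjoint (range w) D"
      unfolding coarsely_disjoint_def
    proof
      fix R
      have "{a \<in> range w. \<exists>b \<in> D. d a b \<le> R} \<subseteq> w ` {..nat \<lceil>R\<rceil>}"
      proof clarify
        fix j b assume "b \<in> D" "d (w j) b \<le> R"
        then have "real j \<le> R" using w_far[of b j] by linarith
        then show "w j \<in> w ` {..nat \<lceil>R\<rceil>}" by (intro imageI) (simp, linarith)
      qed
      then show "bdd {a \<in> range w. \<exists>b \<in> D. d a b \<le> R}"
        by (rule bdd_subset[rotated]) (simp add: bdd_finite)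
    qed
    then have "trace (range w) \<inter> trace D = {}" using trace_disjoint_iff[OF WM DM] by blast
    moreover have "\<not> bdd (range w)"
      unfolding bdd_def
    proof
      assume "\<exists>R. \<forall>x \<in> range w. d p0 x \<le> R"
      then obtain R where R: "\<And>j. d p0 (w j) \<le> R" by blast
      obtain j :: nat where "R + d p0 (z 0) \<le> real j" using real_arch_simple by blast
      then show False
        using w(2)[of j 0] \<rho>0[of j] R[of j] mdist_triangle[OF w(1) base z, of j 0] mdist_commute[of X p0 "w j"]
        by linarith
    qed
    then have "trace (range w) \<noteq> {}" using trace_empty_iff[OF WM] by blast
    ultimately show ?thesis using trace_subset[of "range w"] by blast
  qed
  moreover
  \<comment> \<open>Thickening by \<open>r\<close> adds nothing to the trace, so
    \<open>trace (M - N)\<close> is a closed set covering the rest of the corona. Its complement is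
    nonempty because the centres \<open>z (n k)\<close> diverge from \<open>M - N\<close>.\<close>
  define N where "N = {x \<in> M. \<exists>a \<in> D. d x a \<le> r}"
  have "trace N \<subseteq> trace D" by (rule trace_enlarge[where r = r]) (use DM in \<open>auto simp: N_def\<close>)
  then have cover: "trace D \<union> trace (M - N) = topspace T"
    using trace_Un[of N "M - N"] trace_space trace_subset[of D] trace_subset[of "M - N"]
    by (auto simp: N_def Un_absorb1)
  have "trace (M - N) \<noteq> topspace T"
  proof -
    let ?Z = "(\<lambda>k. z (n k)) ` UNIV"
    have ZM: "?Z \<subseteq> M" using z by blast
    have "coarsely_disjoint ?Z (M - N)"
      unfolding coarsely_disjoint_def
    proof
      fix R
      have "{a \<in> ?Z. \<exists>b \<in> M - N. d a b \<le> R} \<subseteq> (\<lambda>k. z (n k)) ` {..nat \<lceil>\<sigma> R\<rceil>}"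
      proof clarify
        fix k b assume b: "b \<in> M" "b \<notin> N" "d (z (n k)) b \<le> R"
        \<comment> \<open>Otherwise \<open>f b\<close> falls in the \<open>k\<close>-th ball, and
          \<open>b\<close> is within \<open>r\<close> of \<open>g (f b)\<close> in
          \<open>E k\<close>, hence in \<open>N\<close>.\<close>
        have "\<not> \<sigma> R \<le> real k"
        proof
          assume "\<sigma> R \<le> real k"
          then have "mdist Y (f (z (n k))) (f b) \<le> real k" using \<sigma>(3)[OF z b(1,3)] by linarith
          then have "g (f b) \<in> E k" using f b by (auto simp: E_def)
          moreover have "d b (g (f b)) \<le> r" using gf[OF b(1)] mdist_commute[of X b] by simp
          ultimately show False using b by (auto simp: N_def D_def)
        qed
        then show "z (n k) \<in> (\<lambda>k. z (n k)) ` {..nat \<lceil>\<sigma> R\<rceil>}" by (intro imageI) (simp, linarith)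
      qed
      then show "bdd {a \<in> ?Z. \<exists>b \<in> M - N. d a b \<le> R}"
        by (rule bdd_subset[rotated]) (simp add: bdd_finite)
    qed
    then have "trace ?Z \<inter> trace (M - N) = {}" using trace_disjoint_iff[OF ZM] by blast
    moreover have "\<not> bdd ?Z"
      unfolding bdd_def
    proof
      assume "\<exists>R. \<forall>x \<in> ?Z. d p0 x \<le> R"
      then obtain R where R: "\<And>k. d p0 (z (n k)) \<le> R" by blast
      obtain k :: nat where "R \<le> real k" using real_arch_simple by blast
      then show False using n(2)[of k] \<rho>0[of k] R[of k] by linarith
    qed
    then have "trace ?Z \<noteq> {}" using trace_empty_iff[OF ZM] by blast
    ultimately show ?thesis using trace_subset[of ?Z] by blast
  qed
  ultimately show ?thesis
    using decomposable_if_subcontinuum_with_interior[OF cont closedin_trace _ _ closedin_trace _ cover] by blast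
qed

end

lemma coarsely_equivalent_nat_if_indecomposable:
  assumes "indecomposable_continuum T"
  shows "coarsely_equivalent X (submetric (euclidean_metric :: real metric) \<nat>)"
proof -
  obtain z where z: "\<And>i. z i \<in> M" "\<And>i j. d (z i) (z j) \<le> \<tau> \<bar>real i - real j\<bar> + 1"
    "\<And>i j. \<bar>real i - real j\<bar> \<le> \<sigma> (d (z i) (z j) + 1) + 2 * r" using coarse_ray by blast
  show ?thesis
  proof (cases "\<exists>s. \<forall>x \<in> M. \<exists>i. d x (z i) \<le> s")
    case True
    then show ?thesis using coarsely_equivalent_nat_if_dense[OF z] by blast
  next
    case False
    then have "decomposable T"
      using assms by (intro decomposable_if_not_dense[OF z]) (auto simp: indecomposable_continuum_def not_le)
    then show ?thesis using assms unfolding indecomposable_continuum_def by blast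
  qed
qed

end

theorem theorem3p10:
  fixes X :: "'a metric"
  assumes "proper_metric X"
    and "\<not> compact_space (mtopology_of X)"
  shows "coarsely_equivalent X (submetric (euclidean_metric :: real metric) \<nat>) \<longleftrightarrow>
    (coarsely_geodesic X \<and> coarse_bounded_geometry X) \<and>
    indecomposable_continuum (higson_corona X)"
proof -
  have "mspace X \<noteq> {}"
    using assms(2) by (metis compact_space_def compactin_empty topspace_mtopology_of)
  then obtain p0 where p0: "p0 \<in> mspace X" by blast
  interpret unbounded_proper_metric X p0
  proof
    fix R
    show "\<exists>x \<in> mspace X. R < mdist X p0 x"
    proof (rule ccontr)
      assume "\<not> ?thesis"
      then have "mcball_of X p0 R = topspace (mtopology_of X)" using p0 by (auto simp: not_less)
      moreover have "compactin (mtopology_of X) (mcball_of X p0 R)"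
        using assms(1) p0 unfolding proper_metric_def by blast
      ultimately show False using assms(2) by (simp add: compact_space_def)
    qed
  qed (fact assms(1) p0)+
  let ?N = "submetric (euclidean_metric :: real metric) \<nat>"
  show ?thesis
  proof
    assume "coarsely_equivalent X ?N"
    then obtain f where f: "coarse_equivalence X ?N f" unfolding coarsely_equivalent_def by blast
    obtain g \<sigma> \<tau> r where *: "f \<in> mspace X \<rightarrow> mspace ?N" "g \<in> mspace ?N \<rightarrow> mspace X"
      "\<And>t. 0 \<le> t \<Longrightarrow> 0 \<le> \<sigma> t" "\<And>s t. 0 \<le> s \<Longrightarrow> s \<le> t \<Longrightarrow> \<sigma> s \<le> \<sigma> t"
      "\<And>x x' t. x \<in> mspace X \<Longrightarrow> x' \<in> mspace X \<Longrightarrow> mdist X x x' \<le> t \<Longrightarrow> mdist ?N (f x) (f x') \<le> \<sigma> t"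
      "\<And>t. 0 \<le> t \<Longrightarrow> 0 \<le> \<tau> t" "\<And>s t. 0 \<le> s \<Longrightarrow> s \<le> t \<Longrightarrow> \<tau> s \<le> \<tau> t"
      "\<And>y y' t. y \<in> mspace ?N \<Longrightarrow> y' \<in> mspace ?N \<Longrightarrow> mdist ?N y y' \<le> t \<Longrightarrow> mdist X (g y) (g y') \<le> \<tau> t"
      "0 \<le> r" "\<And>x. x \<in> mspace X \<Longrightarrow> mdist X (g (f x)) x \<le> r"
      "\<And>y. y \<in> mspace ?N \<Longrightarrow> mdist ?N (f (g y)) y \<le> r"
      by (rule coarse_equivalenceE[OF f]) (rule that)
    \<comment> \<open>The values of \<open>f\<close> are natural numbers inside the reals; rounding
      recovers them at type \<open>nat\<close> without loss.\<close>
    have nat: "real (nat \<lfloor>f x\<rfloor>) = f x" if "x \<in> M" for x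
    proof -
      have "f x \<in> \<nat>" using *(1) that by auto
      then show ?thesis by (auto elim: Nats_cases)
    qed
    have gM: "g (real n) \<in> M" for n using *(2) by auto
    interpret coarse_ray_space X p0 "\<lambda>x. nat \<lfloor>f x\<rfloor>" "\<lambda>n. g (real n)" \<sigma> \<tau> r
    proof
      show "\<bar>real (nat \<lfloor>f x\<rfloor>) - real (nat \<lfloor>f y\<rfloor>)\<bar> \<le> \<sigma> t"
        if "x \<in> M" "y \<in> M" "d x y \<le> t" for x y t
        using *(5)[OF that] nat that by (simp add: dist_real_def)
      show "d (g (real m)) (g (real n)) \<le> \<tau> t" if "\<bar>real m - real n\<bar> \<le> t" for m n t
        using *(8)[of "real m" "real n" t] that by (simp add: dist_real_def)
      show "d (g (real (nat \<lfloor>f x\<rfloor>))) x \<le> r" if "x \<in> M" for x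
        using *(10)[OF that] nat[OF that] by simp
      show "\<bar>real (nat \<lfloor>f (g (real n))\<rfloor>) - real n\<bar> \<le> r" for n
        using *(11)[of "real n"] nat[OF gM] by (simp add: dist_real_def)
    qed (fact * gM)+
    show "(coarsely_geodesic X \<and> coarse_bounded_geometry X) \<and> indecomposable_continuum T"
      using coarsely_geodesic coarse_bounded_geometry indecomposable_corona by blast
  next
    assume asm: "(coarsely_geodesic X \<and> coarse_bounded_geometry X) \<and> indecomposable_continuum T"
    then obtain Y :: "('a + real) metric" and f where Y: "geodesic_metric Y" and f: "coarse_equivalence X Y f"
      unfolding coarsely_geodesic_def coarsely_equivalent_def by blast
    obtain g \<sigma> \<tau> r where *: "f \<in> mspace X \<rightarrow> mspace Y" "g \<in> mspace Y \<rightarrow> mspace X"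
      "\<And>t. 0 \<le> t \<Longrightarrow> 0 \<le> \<sigma> t" "\<And>s t. 0 \<le> s \<Longrightarrow> s \<le> t \<Longrightarrow> \<sigma> s \<le> \<sigma> t"
      "\<And>x x' t. x \<in> mspace X \<Longrightarrow> x' \<in> mspace X \<Longrightarrow> mdist X x x' \<le> t \<Longrightarrow> mdist Y (f x) (f x') \<le> \<sigma> t"
      "\<And>t. 0 \<le> t \<Longrightarrow> 0 \<le> \<tau> t" "\<And>s t. 0 \<le> s \<Longrightarrow> s \<le> t \<Longrightarrow> \<tau> s \<le> \<tau> t"
      "\<And>y y' t. y \<in> mspace Y \<Longrightarrow> y' \<in> mspace Y \<Longrightarrow> mdist Y y y' \<le> t \<Longrightarrow> mdist X (g y) (g y') \<le> \<tau> t"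
      "0 \<le> r" "\<And>x. x \<in> mspace X \<Longrightarrow> mdist X (g (f x)) x \<le> r"
      "\<And>y. y \<in> mspace Y \<Longrightarrow> mdist Y (f (g y)) y \<le> r"
      by (rule coarse_equivalenceE[OF f]) (rule that)
    interpret coarsely_geodesic_space X p0 Y f g \<sigma> \<tau> r
      by unfold_locales (use Y *(1,2) in blast | fact *)+
    show "coarsely_equivalent X ?N"
      using coarsely_equivalent_nat_if_indecomposable asm by blast
  qed
qed

end
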